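(* Let $N\ge 1$, let $T$ be the dyadic tree of depth $N$, $T^2=T\times T$ the bi-tree, and let $\mu$ be a non-negative measure on $\partial T^2$. Then the following are equivalent: 1. $\mu$ is a Carleson measure with constant $C_{(1)}$: $\sum_{R\in\mathcal R_E}\mu(R)^2\le C_{(1)}\,\mu(E)$ for all $E\subset\partial T^2$; 2. $\mu$ is hereditary Carleson with constant $C_{(2)}$: for every $E\subset\partial T^2$ the restriction $\mu|E$ is a $C_{(2)}$-Carleson measure; 3. $\mu$ is an embedding measure for the Hardy operator with constant $C_{(3)}$: for all $\varphi:T^2\to\mathbb R$, $\sum_{\omega\in\partial T^2}|\mathbb I\varphi(\omega)|^2\mu(\omega)\le C_{(3)}\|\varphi\|^2_{\ell^2(T^2)}$; 4. $\mu$ satisfies the second embedding with constant $C_{(4)}$: for all $\psi:\partial T^2\to\mathbb R$, $\sum_{\alpha\in T^2}|\mathbb I^*(\psi\mu)(\alpha)|^2\le C_{(4)}\sum_{\omega\in\partial T^2}|\psi(\omega)|^2\mu(\omega)$. Here equivalence is quantitative: for all $i,j\in\{1,2,3,4\}$, if $(i)$ holds with some constant $C_{(i)}$, then $(j)$ holds with a constant $C_{(j)}$ that depends only on $C_{(i)}$ (and not on $N$ or $\mu$).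
   Context: $T$ is the finite dyadic tree of depth $N$: its nodes are the dyadic subintervals of $[0,1]$ of length $2^{-k}$, $0\le k\le N$; its boundary $\partial T$ is the set of dyadic intervals of length $2^{-N}$. The bi-tree is $T^2=T\times T$; a node $\alpha\in T^2$ is identified with the dyadic rectangle $R_\alpha\subset[0,1]^2$, and $\alpha\le\beta$ means $R_\alpha\subset R_\beta$. The boundary $\partial T^2=(\partial T)^2$ consists of the dyadic squares $\omega$ (also written $R_\omega$) of side $2^{-N}$. A measure $\mu$ on $\partial T^2$ assigns a finite mass $\mu(\omega)\ge0$ to each $\omega\in\partial T^2$; it is extended by $\mu(\alpha)=0$ for nodes $\alpha\in T^2\setminus\partial T^2$. For a dyadic rectangle $R=R_\alpha$, $\mu(R_\alpha)=\sum_{\omega\in\partial T^2,\ \omega\le\alpha}\mu(\omega)$; for $E\subset\partial T^2$, $\mu(E)=\sum_{\omega\in E}\mu(\omega)$. For $E\subset\partial T^2$, $U_E=\bigcup_{\omega\in E}R_\omega$ and $\mathcal R_E$ is the collection of all dyadic rectangles $R$ (nodes of $T^2$) with $R\subset U_E$. The restriction $\mu|E$ is the measure with $(\mu|E)(\omega)=\mu(\omega)$ if $\omega\in E$ and $0$ otherwise. A measure $\nu$ on $\partial T^2$ is $C$-Carleson if $\sum_{R\in\mathcal R_F}\nu(R)^2\le C\,\nu(F)$ for all $F\subset\partial T^2$. Hardy operator: $\mathbb I\varphi(\alpha)=\sum_{\beta\ge\alpha}\varphi(\beta)$, and $\mathbb I^*\psi(\alpha)=\sum_{\beta\le\alpha}\psi(\beta)$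 for functions on $T^2$. Thus $\mathbb I^*(\psi\mu)(\alpha)=\sum_{\omega\in\partial T^2,\ \omega\le\alpha}\psi(\omega)\mu(\omega)$. $\|\varphi\|^2_{\ell^2(T^2)}=\sum_{\alpha\in T^2}\varphi(\alpha)^2$. *)

theory Defs
  imports Complex_Main
begin

definition dyadic_interval :: "nat \<Rightarrow> nat \<Rightarrow> real set" where
  "dyadic_interval k j = {real j / 2 ^ k .. (real j + 1) / 2 ^ k}"

definition tree :: "nat \<Rightarrow> real set set" where
  "tree N = {dyadic_interval k j | k j. k \<le> N \<and> j < 2 ^ k}"

definition tree_boundary :: "nat \<Rightarrow> real set set" where
  "tree_boundary N = {dyadic_interval N j | j. j < 2 ^ N}"

type_synonym node = "real set \<times> real set"

definition bitree :: "nat \<Rightarrow> node set" where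
  "bitree N = tree N \<times> tree N"

definition bitree_boundary :: "nat \<Rightarrow> node set" where
  "bitree_boundary N = tree_boundary N \<times> tree_boundary N"

definition rect :: "node \<Rightarrow> (real \<times> real) set" where
  "rect \<alpha> = fst \<alpha> \<times> snd \<alpha>"

definition node_le :: "node \<Rightarrow> node \<Rightarrow> bool" (infix "\<preceq>" 50) where
  "\<alpha> \<preceq> \<beta> \<longleftrightarrow> rect \<alpha> \<subseteq> rect \<beta>"

lemma finite_tree: "finite (tree N)"
proof -
  have "tree N = (\<Union>k\<in>{..N}. dyadic_interval k ` {..<2 ^ k})"
    by (auto simp: tree_def)
  then show ?thesis by simp
qed

lemma tree_boundary_subset: "tree_boundary N \<subseteq> tree N"
  by (auto simp: tree_def tree_boundary_def)

lemma finite_bitree: "finite (bitree N)"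
  by (simp add: bitree_def finite_tree)

lemma bitree_boundary_subset: "bitree_boundary N \<subseteq> bitree N"
  using tree_boundary_subset by (auto simp: bitree_def bitree_boundary_def)

text \<open>A measure on the boundary is a function on nodes, extended by zero to the interior nodes.
  Its values outside the bi-tree play no role.\<close>
definition boundary_measure :: "nat \<Rightarrow> (node \<Rightarrow> real) \<Rightarrow> bool" where
  "boundary_measure N \<mu> \<longleftrightarrow>
     (\<forall>\<omega>\<in>bitree_boundary N. 0 \<le> \<mu> \<omega>) \<and> (\<forall>\<alpha>\<in>bitree N - bitree_boundary N. \<mu> \<alpha> = 0)"

definition rect_mass :: "nat \<Rightarrow> (node \<Rightarrow> real) \<Rightarrow> node \<Rightarrow> real" where
  "rect_mass N \<mu> \<alpha> = (\<Sum>\<omega>\<in>{\<omega> \<in> bitree_boundary N. \<omega> \<preceq> \<alpha>}. \<mu> \<omega>)"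

definition restrict_measure :: "(node \<Rightarrow> real) \<Rightarrow> node set \<Rightarrow> node \<Rightarrow> real" where
  "restrict_measure \<mu> E \<omega> = (if \<omega> \<in> E then \<mu> \<omega> else 0)"

definition rects_inside :: "nat \<Rightarrow> node set \<Rightarrow> node set" where
  "rects_inside N E = {\<alpha> \<in> bitree N. rect \<alpha> \<subseteq> (\<Union>\<omega>\<in>E. rect \<omega>)}"

definition hardy :: "nat \<Rightarrow> (node \<Rightarrow> real) \<Rightarrow> node \<Rightarrow> real" where
  "hardy N \<phi> \<alpha> = (\<Sum>\<beta>\<in>{\<beta> \<in> bitree N. \<alpha> \<preceq> \<beta>}. \<phi> \<beta>)"

definition hardy_adjoint :: "nat \<Rightarrow> (node \<Rightarrow> real) \<Rightarrow> node \<Rightarrow> real" where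
  "hardy_adjoint N \<psi> \<alpha> = (\<Sum>\<beta>\<in>{\<beta> \<in> bitree N. \<beta> \<preceq> \<alpha>}. \<psi> \<beta>)"

definition carleson :: "nat \<Rightarrow> (node \<Rightarrow> real) \<Rightarrow> real \<Rightarrow> bool" where
  "carleson N \<mu> C \<longleftrightarrow>
     (\<forall>E. E \<subseteq> bitree_boundary N \<longrightarrow>
        (\<Sum>\<alpha>\<in>rects_inside N E. (rect_mass N \<mu> \<alpha>)\<^sup>2) \<le> C * (\<Sum>\<omega>\<in>E. \<mu> \<omega>))"

definition hereditary_carleson :: "nat \<Rightarrow> (node \<Rightarrow> real) \<Rightarrow> real \<Rightarrow> bool" where
  "hereditary_carleson N \<mu> C \<longleftrightarrow>
     (\<forall>E. E \<subseteq> bitree_boundary N \<longrightarrow> carleson N (restrict_measure \<mu> E) C)"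

definition hardy_embedding :: "nat \<Rightarrow> (node \<Rightarrow> real) \<Rightarrow> real \<Rightarrow> bool" where
  "hardy_embedding N \<mu> C \<longleftrightarrow>
     (\<forall>\<phi>. (\<Sum>\<omega>\<in>bitree_boundary N. \<bar>hardy N \<phi> \<omega>\<bar>\<^sup>2 * \<mu> \<omega>) \<le> C * (\<Sum>\<alpha>\<in>bitree N. (\<phi> \<alpha>)\<^sup>2))"

text \<open>Since \<open>\<mu>\<close> vanishes at interior nodes, only the values of \<open>\<psi>\<close> on the boundary matter.\<close>
definition second_embedding :: "nat \<Rightarrow> (node \<Rightarrow> real) \<Rightarrow> real \<Rightarrow> bool" where
  "second_embedding N \<mu> C \<longleftrightarrow>
     (\<forall>\<psi>. (\<Sum>\<alpha>\<in>bitree N. \<bar>hardy_adjoint N (\<lambda>\<omega>. \<psi> \<omega> * \<mu> \<omega>) \<alpha>\<bar>\<^sup>2)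
           \<le> C * (\<Sum>\<omega>\<in>bitree_boundary N. \<bar>\<psi> \<omega>\<bar>\<^sup>2 * \<mu> \<omega>))"

end

theory Submission
  imports Defs "HOL-Analysis.Convex" "HOL-Library.Product_Order"
begin

text \<open>
  The substance of the equivalence is the passage from the Carleson condition to the second
  embedding; the Hardy embedding and the second embedding are dual to each other, and testing the second
  embedding on indicator functions gives the hereditary Carleson condition.

  For $\psi \ge 0$ put $f = \mathbb I^*(\psi\mu)$, $u = \mathbb I f$ and
  $\mathcal E = \sum_\alpha f(\alpha)^2 = \sum_\omega u(\omega)\psi(\omega)\mu(\omega)$. Some constant
  $\Lambda$ is admissible in the second embedding because the bi-tree is finite. The idea is that
  an admissible $\Lambda$ can be halved as long as it is at least a fixed multiple of the Carleson
  constant $C$ (\<open>embedding_halving\<close>); hence that multiple of $C$ is itself admissible. To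
  halve $\Lambda$, the energy $\mathcal E$ is split into three parts.

  \<^item> Boundary nodes where $\psi \ge 4u/\Lambda$ contribute at most
    $\frac{\Lambda}{4}\sum_\omega \psi^2\mu$.

  \<^item> At the other boundary nodes, the ancestors $\beta$ of $\omega$ with
    $u(\beta) > \varepsilon u(\omega)$ satisfy $\psi(\omega) \le \frac{4}{\Lambda\varepsilon} u(\beta)$.
    Their contribution is therefore at most
    $\frac{4}{\Lambda\varepsilon}\sum_\beta f(\beta)u(\beta)\mu(R_\beta)$. The set of nodes with
    $u \ge t$ is closed under passing to descendants, so the Carleson condition, applied on each
    level set of $u$, gives $\sum_\beta u(\beta)^2\mu(R_\beta)^2 \le C\sum_\omega u^2\mu$
    (\<open>carleson_level_sets\<close>), and $\sum_\omega u^2\mu \le \Lambda\mathcal E$ by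
    duality. This part is small when $\Lambda$ is large compared with $C$.

  \<^item> There remain the ancestors $\beta$ of $\omega$ with $u(\beta) \le \varepsilon u(\omega)$. On a
    single tree these would form a chain and the sum of $f$ over them would be at most
    $\varepsilon u(\omega)$. On the bi-tree this maximum principle fails, because the ancestors of
    $\omega$ form a grid. Its replacement is a function $\varphi$ with
    $\sum f(\beta) \le \eta u(\omega) + 2\,\mathbb I\varphi(\omega)$, the sum extending over these
    $\beta$ for $\varepsilon = \eta^3$ (\<open>low_potential_bound\<close>), and with
    $\|\varphi\|^2 \le 6\eta\|f\|^2$ (\<open>majorant_norm\<close>). Since
    $\sum_\omega \psi\mu\,\mathbb I\varphi = \sum_\alpha \varphi f$, this part is small when
    $\eta$ is small.

  The function $\varphi$ is a discrete form of $\partial_x u\,\partial_y u / u$, in which one of the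
  two derivatives is summed only over nodes of much smaller potential. Its norm is estimated by
  Hardy's inequality on the chains of one tree, and this cut-off produces the factor $\eta$.
  Hardy's inequality is available on the tree because the other derivative, as a function of the
  first coordinate, is the mass function of a measure on the boundary
  (\<open>tree_hardy_inequality\<close>).
\<close>

section \<open>Sums along finite chains\<close>

text \<open>
  Along a chain, read from the top downwards, the partial sums of \<open>h\<close> are the nodes of a partition
  of $[0, \sum h]$, and the left side is a Riemann sum of \<open>g\<close> with values taken at right
  end points. The hypothesis on \<open>G\<close> says that each term is at most the increment of \<open>G\<close>; it holds for
  instance when \<open>g\<close> is decreasing with primitive \<open>G\<close>. The three chain estimates that
  follow are instances of this.
\<close>
lemma chain_riemann_sum:
  fixes A :: "'a::order set" and h :: "'a \<Rightarrow> real" and g G :: "real \<Rightarrow> real"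
  assumes "finite A" and "\<And>x y. x \<in> A \<Longrightarrow> y \<in> A \<Longrightarrow> x \<le> y \<or> y \<le> x"
    and "\<And>x. x \<in> A \<Longrightarrow> 0 \<le> h x"
    and step: "\<And>x y. 0 \<le> x \<Longrightarrow> x \<le> y \<Longrightarrow> (y - x) * g y \<le> G y - G x"
  shows "(\<Sum>k\<in>A. h k * g (\<Sum>l\<in>{l\<in>A. k \<le> l}. h l)) \<le> G (sum h A) - G 0"
  using assms(1-3)
proof (induction A rule: finite_psubset_induct)
  case (psubset A)
  show ?case
  proof (cases "A = {}")
    case False
    obtain m where m: "m \<in> A" and mmin: "\<And>b. b \<in> A \<Longrightarrow> b \<le> m \<Longrightarrow> m = b"
      using finite_has_minimal[OF psubset.hyps False] by blast
    have mle: "m \<le> k" if "k \<in> A" for k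
      using psubset.prems(1)[OF m that] mmin[OF that] by auto
    let ?B = "A - {m}"
    have IH: "(\<Sum>k\<in>?B. h k * g (\<Sum>l\<in>{l\<in>?B. k \<le> l}. h l)) \<le> G (sum h ?B) - G 0"
      using m psubset.prems by (intro psubset.IH) blast+
    have "{l\<in>?B. k \<le> l} = {l\<in>A. k \<le> l}" if "k \<in> ?B" for k
      using that mmin by auto
    then have B: "(\<Sum>k\<in>?B. h k * g (\<Sum>l\<in>{l\<in>A. k \<le> l}. h l)) \<le> G (sum h ?B) - G 0"
      using IH by simp
    have split: "sum h A = h m + sum h ?B"
      using psubset.hyps m by (simp add: sum.remove)
    have "{l\<in>A. m \<le> l} = A" using mle by auto
    then have "(\<Sum>k\<in>A. h k * g (\<Sum>l\<in>{l\<in>A. k \<le> l}. h l))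
        = h m * g (sum h A) + (\<Sum>k\<in>?B. h k * g (\<Sum>l\<in>{l\<in>A. k \<le> l}. h l))"
      using psubset.hyps m by (simp add: sum.remove)
    moreover have "h m * g (sum h A) \<le> G (sum h A) - G (sum h ?B)"
    proof -
      have "0 \<le> sum h ?B" using psubset.prems(2) by (intro sum_nonneg) auto
      then show ?thesis
        using step[of "sum h ?B" "sum h A"] psubset.prems(2)[OF m] split by simp
    qed
    ultimately show ?thesis using B by linarith
  qed simp
qed

text \<open>The maximum principle on a chain, which is what a single tree offers and a grid does not.\<close>
lemma chain_sum_below:
  fixes A :: "'a::order set" and h :: "'a \<Rightarrow> real"
  assumes "finite A" and "\<And>x y. x \<in> A \<Longrightarrow> y \<in> A \<Longrightarrow> x \<le> y \<or> y \<le> x"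
    and "\<And>x. x \<in> A \<Longrightarrow> 0 \<le> h x" and "0 \<le> K"
  shows "(\<Sum>k\<in>{k\<in>A. (\<Sum>l\<in>{l\<in>A. k \<le> l}. h l) \<le> K}. h k) \<le> K"
proof -
  let ?H = "\<lambda>k. \<Sum>l\<in>{l\<in>A. k \<le> l}. h l"
  have "(\<Sum>k\<in>{k\<in>A. ?H k \<le> K}. h k) = (\<Sum>k\<in>A. h k * (if ?H k \<le> K then 1 else 0))"
    using assms(1) by (simp add: sum.inter_filter if_distrib cong: if_cong)
  also have "\<dots> \<le> min (sum h A) K - min 0 K"
    by (rule chain_riemann_sum[OF assms(1-3), where G = "\<lambda>t. min t K"]) auto
  finally show ?thesis using \<open>0 \<le> K\<close> by linarith
qed

lemma chain_sum_inverse_sqrt: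
  fixes A :: "'a::order set" and h :: "'a \<Rightarrow> real"
  assumes "finite A" and "\<And>x y. x \<in> A \<Longrightarrow> y \<in> A \<Longrightarrow> x \<le> y \<or> y \<le> x"
    and "\<And>x. x \<in> A \<Longrightarrow> 0 \<le> h x" and K: "0 \<le> K"
  defines "H \<equiv> \<lambda>k. \<Sum>l\<in>{l\<in>A. k \<le> l}. h l"
  shows "(\<Sum>k\<in>{k\<in>A. H k \<le> K}. h k / sqrt (H k)) \<le> 2 * sqrt K"
proof -
  have step: "(y - x) * (if y \<le> K then 1 / sqrt y else 0) \<le> 2 * sqrt (min y K) - 2 * sqrt (min x K)"
    if "0 \<le> x" "x \<le> y" for x y
  proof (cases "y \<le> K \<and> 0 < y")
    case True
    have "y - x = (sqrt y - sqrt x) * (sqrt y + sqrt x)"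
      using that by (simp add: algebra_simps)
    also have "\<dots> \<le> (sqrt y - sqrt x) * (2 * sqrt y)"
      using that by (intro mult_left_mono) auto
    finally have "(y - x) * (1 / sqrt y) \<le> 2 * sqrt y - 2 * sqrt x"
      using True by (simp add: field_simps)
    then show ?thesis using True that by (simp add: min_def)
  next
    case False
    have "sqrt (min x K) \<le> sqrt (min y K)" using that by auto
    moreover have "y = 0" if "y \<le> K" using that False \<open>0 \<le> x\<close> \<open>x \<le> y\<close> by auto
    ultimately show ?thesis by auto
  qed
  have "(\<Sum>k\<in>{k\<in>A. H k \<le> K}. h k / sqrt (H k)) = (\<Sum>k\<in>A. h k * (if H k \<le> K then 1 / sqrt (H k) else 0))"
    using assms(1) by (simp add: sum.inter_filter if_distrib cong: if_cong)
  also have "\<dots> \<le> 2 * sqrt (min (sum h A) K) - 2 * sqrt (min 0 K)"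
    unfolding H_def
    by (rule chain_riemann_sum[OF assms(1-3), where G = "\<lambda>t. 2 * sqrt (min t K)"]) (use step in auto)
  also have "\<dots> \<le> 2 * sqrt K" using K by simp
  finally show ?thesis .
qed

lemma chain_sum_tail:
  fixes A :: "'a::order set" and h :: "'a \<Rightarrow> real"
  assumes "finite A" and "\<And>x y. x \<in> A \<Longrightarrow> y \<in> A \<Longrightarrow> x \<le> y \<or> y \<le> x"
    and "\<And>x. x \<in> A \<Longrightarrow> 0 \<le> h x" and K: "0 < K"
  defines "H \<equiv> \<lambda>k. \<Sum>l\<in>{l\<in>A. k \<le> l}. h l"
  shows "(\<Sum>k\<in>{k\<in>A. K \<le> H k}. h k / (H k * sqrt (H k))) \<le> 3 / sqrt K"
proof -
  define G where "G = (\<lambda>t. if t \<le> K then t / (K * sqrt K) else 3 / sqrt K - 2 / sqrt t)"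
  have GK: "K / (K * sqrt K) = 3 / sqrt K - 2 / sqrt K" using K by (simp add: field_simps)
  have large: "(y - x) / (y * sqrt y) \<le> 2 / sqrt x - 2 / sqrt y" if "0 < x" "x \<le> y" for x y :: real
  proof -
    define a b where "a = sqrt x" and "b = sqrt y"
    have ab: "0 < a" "a \<le> b" "x = a * a" "y = b * b" "b > 0"
      using that by (auto simp: a_def b_def)
    have "(b * b - a * a) * (a * b) \<le> (2 * b - 2 * a) * (b * b * b)"
    proof -
      have "a * (a + b) \<le> b * (b + b)" using ab by (intro mult_mono) auto
      then have "(b - a) * b * (a * (a + b)) \<le> (b - a) * b * (b * (b + b))"
        using ab by (intro mult_left_mono) auto
      then show ?thesis by (simp add: algebra_simps)
    qed
    then have "(b * b - a * a) / (b * b * b) \<le> (2 * b - 2 * a) / (a * b)"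
      using ab by (intro divide_le_eq[THEN iffD2]) (auto simp: field_simps)
    also have "\<dots> = 2 / a - 2 / b" using ab by (simp add: field_simps)
    finally show ?thesis using ab by (simp add: a_def[symmetric] b_def[symmetric])
  qed
  have step: "(y - x) * (if K \<le> y then 1 / (y * sqrt y) else 0) \<le> G y - G x"
    if xy: "0 \<le> x" "x \<le> y" for x y
  proof -
    consider "y < K" | "K \<le> x" | "x < K" "K \<le> y" by linarith
    then show ?thesis
    proof cases
      case 1 then show ?thesis using xy K by (simp add: G_def divide_right_mono)
    next
      case 2
      have "G t = 3 / sqrt K - 2 / sqrt t" if "K \<le> t" for t
        using that GK by (auto simp: G_def)
      then show ?thesis using 2 xy K large[of x y] by simp
    next
      case 3
      have y: "G y = 3 / sqrt K - 2 / sqrt y" using 3 GK by (auto simp: G_def)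
      have x: "G x = K / (K * sqrt K) - (K - x) / (K * sqrt K)"
        using 3 by (simp add: G_def diff_divide_distrib)
      have "(K - x) / (y * sqrt y) \<le> (K - x) / (K * sqrt K)"
        using 3 K by (intro divide_left_mono mult_mono) auto
      moreover have "(y - x) / (y * sqrt y) = (y - K) / (y * sqrt y) + (K - x) / (y * sqrt y)"
        by (simp add: add_divide_distrib[symmetric])
      ultimately show ?thesis using large[of K y] 3 K x y GK by simp
    qed
  qed
  have "(\<Sum>k\<in>{k\<in>A. K \<le> H k}. h k / (H k * sqrt (H k)))
      = (\<Sum>k\<in>A. h k * (if K \<le> H k then 1 / (H k * sqrt (H k)) else 0))"
    using assms(1) by (simp add: sum.inter_filter if_distrib cong: if_cong)
  also have "\<dots> \<le> G (sum h A) - G 0"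
    unfolding H_def by (rule chain_riemann_sum[OF assms(1-3), where G = G]) (use step in \<open>auto simp del: mult_cancel_left\<close>)
  also have "\<dots> \<le> 3 / sqrt K"
  proof -
    have "G 0 = 0" using K by (simp add: G_def)
    moreover have "G t \<le> 3 / sqrt K" if "0 \<le> t" for t
    proof (cases "t \<le> K")
      case True
      then have "t / (K * sqrt K) \<le> K / (K * sqrt K)" using K by (intro divide_right_mono) auto
      also have "\<dots> \<le> 3 / sqrt K" unfolding GK using K by (simp add: diff_divide_distrib[symmetric] divide_right_mono)
      finally show ?thesis using True by (simp add: G_def)
    qed (use K in \<open>simp add: G_def\<close>)
    ultimately show ?thesis using assms(3) by (simp add: sum_nonneg)
  qed
  finally show ?thesis .
qed

lemma square_sum_le_product:
  fixes f x y :: "'a \<Rightarrow> real"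
  assumes "\<And>i. i \<in> A \<Longrightarrow> 0 \<le> x i" "\<And>i. i \<in> A \<Longrightarrow> 0 \<le> y i"
    and "\<And>i. i \<in> A \<Longrightarrow> (f i)\<^sup>2 = x i * y i"
  shows "(sum f A)\<^sup>2 \<le> sum x A * sum y A"
proof -
  have "\<bar>sum f A\<bar> \<le> (\<Sum>i\<in>A. \<bar>f i\<bar>)" by (rule sum_abs)
  also have "\<dots> = (\<Sum>i\<in>A. sqrt (x i) * sqrt (y i))"
    using assms(3) by (intro sum.cong refl) (simp add: real_sqrt_mult[symmetric] flip: real_sqrt_abs)
  finally have "(sum f A)\<^sup>2 \<le> (\<Sum>i\<in>A. sqrt (x i) * sqrt (y i))\<^sup>2"
    by (metis abs_ge_zero power2_abs power_mono)
  also have "\<dots> \<le> (\<Sum>i\<in>A. (sqrt (x i))\<^sup>2) * (\<Sum>i\<in>A. (sqrt (y i))\<^sup>2)"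
    by (rule Cauchy_Schwarz_ineq_sum)
  also have "\<dots> = sum x A * sum y A" using assms(1,2) by (auto intro!: arg_cong2[where f="(*)"] sum.cong)
  finally show ?thesis .
qed

text \<open>
  Hardy's inequality in $L^2(h)$ for the averages of \<open>f / h\<close>, restricted to the part of the chain where the
  partial sum $H$ has not yet reached the fraction $\eta$ of its current value. Applying the
  Cauchy--Schwarz inequality with the weight $H^{1/2}$ to the inner sum leaves the two power sums
  estimated in \<open>chain_sum_inverse_sqrt\<close> and \<open>chain_sum_tail\<close>; each contributes a factor
  $\eta^{1/2}$.
\<close>
lemma chain_hardy_inequality:
  fixes A :: "'a::order set" and f h :: "'a \<Rightarrow> real"
  assumes fin: "finite A" and chain: "\<And>x y. x \<in> A \<Longrightarrow> y \<in> A \<Longrightarrow> x \<le> y \<or> y \<le> x"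
    and h: "\<And>x. x \<in> A \<Longrightarrow> 0 \<le> h x"
    and supp: "\<And>x. x \<in> A \<Longrightarrow> h x = 0 \<Longrightarrow> f x = 0" and eta: "0 < \<eta>"
  defines "H \<equiv> \<lambda>k. \<Sum>l\<in>{l\<in>A. k \<le> l}. h l"
  shows "(\<Sum>k\<in>A. h k * ((\<Sum>i\<in>{i\<in>A. k \<le> i \<and> H i \<le> \<eta> * H k}. f i) / H k)\<^sup>2)
      \<le> 6 * \<eta> * (\<Sum>i\<in>A. (f i)\<^sup>2 / h i)"
proof -
  have Hge: "h k \<le> H k" if "k \<in> A" for k
    unfolding H_def using fin h that by (intro member_le_sum) auto
  have H0: "0 \<le> H k" if "k \<in> A" for k
    using Hge[OF that] h[OF that] by simp
  define x where "x i = (f i)\<^sup>2 / h i * sqrt (H i)" for i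
  have x0: "0 \<le> x i" if "i \<in> A" for i
    using h[OF that] H0[OF that] by (simp add: x_def)
  have P: "(\<Sum>i\<in>{i\<in>A. k \<le> i \<and> H i \<le> \<eta> * H k}. f i)\<^sup>2
      \<le> (\<Sum>i\<in>{i\<in>A. H i \<le> \<eta> * H k}. x i) * (2 * sqrt (\<eta> * H k))" if k: "k \<in> A" for k
  proof -
    let ?S = "{i\<in>A. k \<le> i \<and> H i \<le> \<eta> * H k}" and ?S' = "{i\<in>A. H i \<le> \<eta> * H k}"
    have "(\<Sum>i\<in>?S. f i)\<^sup>2 \<le> (\<Sum>i\<in>?S. x i) * (\<Sum>i\<in>?S. h i / sqrt (H i))"
    proof (rule square_sum_le_product)
      fix i assume "i \<in> ?S"
      then have i: "i \<in> A" by simp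
      show "0 \<le> x i" "0 \<le> h i / sqrt (H i)" using x0 h H0 i by auto
      show "(f i)\<^sup>2 = x i * (h i / sqrt (H i))"
        using supp[OF i] h[OF i] Hge[OF i] by (cases "h i = 0") (auto simp: x_def)
    qed
    also have "\<dots> \<le> (\<Sum>i\<in>?S'. x i) * (\<Sum>i\<in>?S'. h i / sqrt (H i))"
      using fin x0 h H0 by (intro mult_mono sum_mono2 sum_nonneg) auto
    also have "\<dots> \<le> (\<Sum>i\<in>?S'. x i) * (2 * sqrt (\<eta> * H k))"
      unfolding H_def
      using fin x0 H0[OF k] eta
      by (intro mult_left_mono chain_sum_inverse_sqrt chain h sum_nonneg) (auto simp: H_def)
    finally show ?thesis .
  qed
  have "(\<Sum>k\<in>A. h k * ((\<Sum>i\<in>{i\<in>A. k \<le> i \<and> H i \<le> \<eta> * H k}. f i) / H k)\<^sup>2)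
      \<le> (\<Sum>k\<in>A. h k * (((\<Sum>i\<in>{i\<in>A. H i \<le> \<eta> * H k}. x i) * (2 * sqrt (\<eta> * H k))) / (H k)\<^sup>2))"
    using P h by (intro sum_mono mult_left_mono) (auto simp: power_divide divide_right_mono)
  also have "\<dots> = (\<Sum>k\<in>A. \<Sum>i\<in>A. if H i \<le> \<eta> * H k then
        2 * sqrt \<eta> * x i * (h k / (H k * sqrt (H k))) else 0)"
  proof (intro sum.cong refl)
    fix k assume k: "k \<in> A"
    have "sqrt (\<eta> * H k) / (H k)\<^sup>2 = sqrt \<eta> / (H k * sqrt (H k))"
    proof (cases "H k = 0")
      case False
      have "sqrt (H k) * sqrt (H k) = H k" using H0[OF k] by simp
      then have "sqrt (H k) * (H k * sqrt (H k)) = (H k)\<^sup>2" by (simp add: power2_eq_square mult.left_commute)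
      then show ?thesis using False by (simp add: frac_eq_eq real_sqrt_mult)
    qed simp
    then have *: "h k * (X * (2 * sqrt (\<eta> * H k)) / (H k)\<^sup>2) = X * (2 * sqrt \<eta> * (h k / (H k * sqrt (H k))))" for X
      by (metis (no_types, opaque_lifting) mult.assoc mult.commute times_divide_eq_right)
    show "h k * ((\<Sum>i\<in>{i\<in>A. H i \<le> \<eta> * H k}. x i) * (2 * sqrt (\<eta> * H k)) / (H k)\<^sup>2)
      = (\<Sum>i\<in>A. if H i \<le> \<eta> * H k then 2 * sqrt \<eta> * x i * (h k / (H k * sqrt (H k))) else 0)"
      unfolding * unfolding sum.inter_filter[OF fin, symmetric] sum_distrib_right
      by (intro sum.cong refl) (simp add: ac_simps)
  qed
  also have "\<dots> = (\<Sum>i\<in>A. \<Sum>k\<in>A. if H i \<le> \<eta> * H k then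
        2 * sqrt \<eta> * x i * (h k / (H k * sqrt (H k))) else 0)"
    by (rule sum.swap)
  also have "\<dots> \<le> (\<Sum>i\<in>A. 6 * \<eta> * ((f i)\<^sup>2 / h i))"
  proof (rule sum_mono)
    fix i assume i: "i \<in> A"
    have eq: "(\<Sum>k\<in>A. if H i \<le> \<eta> * H k then 2 * sqrt \<eta> * x i * (h k / (H k * sqrt (H k))) else 0)
        = 2 * sqrt \<eta> * x i * (\<Sum>k\<in>{k\<in>A. H i / \<eta> \<le> H k}. h k / (H k * sqrt (H k)))"
      unfolding sum.inter_filter[OF fin, symmetric] sum_distrib_left
      using eta by (intro sum.cong) (auto simp: field_simps)
    show "(\<Sum>k\<in>A. if H i \<le> \<eta> * H k then 2 * sqrt \<eta> * x i * (h k / (H k * sqrt (H k))) else 0)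
        \<le> 6 * \<eta> * ((f i)\<^sup>2 / h i)"
    proof (cases "H i = 0")
      case True
      then have "f i = 0" "x i = 0" using supp[OF i] Hge[OF i] h[OF i] by (auto simp: x_def)
      then show ?thesis unfolding eq by simp
    next
      case False
      then have pos: "0 < H i" using H0[OF i] by simp
      have "2 * sqrt \<eta> * x i * (\<Sum>k\<in>{k\<in>A. H i / \<eta> \<le> H k}. h k / (H k * sqrt (H k)))
          \<le> 2 * sqrt \<eta> * x i * (3 / sqrt (H i / \<eta>))"
        unfolding H_def
        using fin x0[OF i] pos eta
        by (intro mult_left_mono chain_sum_tail chain h) (auto simp: H_def)
      also have "\<dots> = 6 * \<eta> * ((f i)\<^sup>2 / h i)"
        using pos eta by (simp add: x_def real_sqrt_divide)
      finally show ?thesis unfolding eq .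
    qed
  qed
  finally show ?thesis by (simp add: sum_distrib_left)
qed

text \<open>The duality of summation over ancestors and over descendants, for an arbitrary incidence relation.\<close>
lemma sum_incidence_swap:
  fixes v X :: "_ \<Rightarrow> real"
  assumes "finite A" "finite B"
  shows "(\<Sum>x\<in>A. (\<Sum>y\<in>{y\<in>B. R y x}. v y) * X x) = (\<Sum>y\<in>B. v y * (\<Sum>x\<in>{x\<in>A. R y x}. X x))"
proof -
  have "(\<Sum>x\<in>A. (\<Sum>y\<in>{y\<in>B. R y x}. v y) * X x) = (\<Sum>x\<in>A. \<Sum>y\<in>{y\<in>B. R y x}. v y * X x)"
    by (simp add: sum_distrib_right)
  also have "\<dots> = (\<Sum>y\<in>B. \<Sum>x\<in>{x\<in>A. R y x}. v y * X x)"
    by (rule sum.swap_restrict[OF assms])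
  finally show ?thesis by (simp add: sum_distrib_left)
qed

section \<open>Comparing weighted sums through level sets\<close>

text \<open>
  Integrating the hypothesis over $t$ would give the claim. The induction does this in finitely many
  steps: it removes from \<open>x\<close> and \<open>y\<close> the layer below the least positive value \<open>m\<close> of \<open>x\<close>, on
  which the level sets of \<open>x\<close> do not change.
\<close>
lemma layer_cake_comparison:
  fixes a x :: "'a \<Rightarrow> real" and b y :: "'b \<Rightarrow> real"
  assumes fin: "finite A" "finite B" and C: "0 \<le> C"
    and b: "\<And>\<omega>. \<omega> \<in> B \<Longrightarrow> 0 \<le> b \<omega>"
    and x: "\<And>\<alpha>. \<alpha> \<in> A \<Longrightarrow> 0 \<le> x \<alpha>" and y: "\<And>\<omega>. \<omega> \<in> B \<Longrightarrow> 0 \<le> y \<omega>"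
    and level: "\<And>t. 0 < t \<Longrightarrow> (\<Sum>\<alpha>\<in>{\<alpha>\<in>A. t \<le> x \<alpha>}. a \<alpha>) \<le> C * (\<Sum>\<omega>\<in>{\<omega>\<in>B. t \<le> y \<omega>}. b \<omega>)"
  shows "(\<Sum>\<alpha>\<in>A. a \<alpha> * x \<alpha>) \<le> C * (\<Sum>\<omega>\<in>B. b \<omega> * y \<omega>)"
  using x y level
proof (induction "card {\<alpha>\<in>A. 0 < x \<alpha>}" arbitrary: x y rule: less_induct)
  case less
  let ?P = "{\<alpha>\<in>A. 0 < x \<alpha>}"
  show ?case
  proof (cases "?P = {}")
    case True
    then have "x \<alpha> = 0" if "\<alpha> \<in> A" for \<alpha> using less.prems(1)[OF that] that by force
    then have "(\<Sum>\<alpha>\<in>A. a \<alpha> * x \<alpha>) = 0" by simp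
    then show ?thesis using C b less.prems(2) by (simp add: sum_nonneg)
  next
    case False
    define m where "m = Min (x ` ?P)"
    have "m \<in> x ` ?P" unfolding m_def using fin False by (intro Min_in) auto
    then obtain \<alpha>0 where \<alpha>0: "\<alpha>0 \<in> A" "x \<alpha>0 = m" "0 < m" by auto
    have mle: "m \<le> x \<alpha>" if "\<alpha> \<in> A" "0 < x \<alpha>" for \<alpha>
      unfolding m_def using fin that by (intro Min_le) auto
    define x' y' where "x' \<alpha> = max 0 (x \<alpha> - m)" and "y' \<omega> = max 0 (y \<omega> - m)" for \<alpha> \<omega>
    have IH: "(\<Sum>\<alpha>\<in>A. a \<alpha> * x' \<alpha>) \<le> C * (\<Sum>\<omega>\<in>B. b \<omega> * y' \<omega>)"
    proof (rule less.hyps)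
      have "{\<alpha>\<in>A. 0 < x' \<alpha>} \<subset> ?P"
      proof (rule psubsetI)
        show "{\<alpha>\<in>A. 0 < x' \<alpha>} \<subseteq> ?P" using \<alpha>0(3) by (auto simp: x'_def)
        have "\<alpha>0 \<in> ?P" "\<alpha>0 \<notin> {\<alpha>\<in>A. 0 < x' \<alpha>}" using \<alpha>0 by (auto simp: x'_def)
        then show "{\<alpha>\<in>A. 0 < x' \<alpha>} \<noteq> ?P" by blast
      qed
      then show "card {\<alpha>\<in>A. 0 < x' \<alpha>} < card ?P" using fin by (intro psubset_card_mono) auto
      fix t :: real assume t: "0 < t"
      have "{\<alpha>\<in>A. t \<le> x' \<alpha>} = {\<alpha>\<in>A. t + m \<le> x \<alpha>}" "{\<omega>\<in>B. t \<le> y' \<omega>} = {\<omega>\<in>B. t + m \<le> y \<omega>}"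
        using t by (auto simp: x'_def y'_def)
      then show "(\<Sum>\<alpha>\<in>{\<alpha>\<in>A. t \<le> x' \<alpha>}. a \<alpha>) \<le> C * (\<Sum>\<omega>\<in>{\<omega>\<in>B. t \<le> y' \<omega>}. b \<omega>)"
        using less.prems(3)[of "t + m"] t \<alpha>0 by simp
    qed (auto simp: x'_def y'_def)
    have "(\<Sum>\<alpha>\<in>A. a \<alpha> * x \<alpha>) = (\<Sum>\<alpha>\<in>A. a \<alpha> * x' \<alpha> + m * (if m \<le> x \<alpha> then a \<alpha> else 0))"
    proof (intro sum.cong refl)
      fix \<alpha> assume \<alpha>: "\<alpha> \<in> A"
      show "a \<alpha> * x \<alpha> = a \<alpha> * x' \<alpha> + m * (if m \<le> x \<alpha> then a \<alpha> else 0)"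
      proof (cases "m \<le> x \<alpha>")
        case True then show ?thesis by (simp add: x'_def algebra_simps)
      next
        case False
        then have "x \<alpha> = 0" using mle[OF \<alpha>] less.prems(1)[OF \<alpha>] by fastforce
        then show ?thesis using False \<alpha>0 by (simp add: x'_def)
      qed
    qed
    also have "\<dots> = (\<Sum>\<alpha>\<in>A. a \<alpha> * x' \<alpha>) + m * (\<Sum>\<alpha>\<in>{\<alpha>\<in>A. m \<le> x \<alpha>}. a \<alpha>)"
      unfolding sum.inter_filter[OF fin(1)] sum_distrib_left sum.distrib ..
    also have "\<dots> \<le> C * (\<Sum>\<omega>\<in>B. b \<omega> * y' \<omega>) + m * (C * (\<Sum>\<omega>\<in>{\<omega>\<in>B. m \<le> y \<omega>}. b \<omega>))"
      using IH less.prems(3)[of m] \<alpha>0 by (intro add_mono mult_left_mono) auto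
    also have "\<dots> = C * (\<Sum>\<omega>\<in>B. b \<omega> * y' \<omega> + m * (if m \<le> y \<omega> then b \<omega> else 0))"
      unfolding sum.inter_filter[OF fin(2)] sum.distrib sum_distrib_left[symmetric]
      by (simp add: algebra_simps)
    also have "\<dots> \<le> C * (\<Sum>\<omega>\<in>B. b \<omega> * y \<omega>)"
    proof (intro mult_left_mono sum_mono C)
      fix \<omega> assume "\<omega> \<in> B"
      then show "b \<omega> * y' \<omega> + m * (if m \<le> y \<omega> then b \<omega> else 0) \<le> b \<omega> * y \<omega>"
        using b[of \<omega>] less.prems(2)[of \<omega>] by (auto simp: y'_def algebra_simps max_def)
    qed
    finally show ?thesis .
  qed
qed

section \<open>Bi-trees over a finite forest\<close>

text \<open>
  What the argument uses of the dyadic tree: it is finite and the ancestors of a boundary node form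
  a chain. The bi-tree is \<open>T \<times> T\<close> with the componentwise order, so \<open>\<alpha> \<le> \<beta>\<close> means that
  \<open>\<beta>\<close> is an ancestor of \<open>\<alpha>\<close>.
\<close>
locale finite_forest =
  fixes T L :: "'a::order set"
  assumes finite_T: "finite T"
    and leaves_subset: "L \<subseteq> T"
    and ancestors_chain: "b \<in> L \<Longrightarrow> x \<in> T \<Longrightarrow> y \<in> T \<Longrightarrow> b \<le> x \<Longrightarrow> b \<le> y \<Longrightarrow> x \<le> y \<or> y \<le> x"
begin

lemma finite_L: "finite L"
  using finite_T leaves_subset by (rule finite_subset[rotated])

lemma ancestors_of_ancestor:
  "b \<le> k \<Longrightarrow> {l \<in> {x\<in>T. b \<le> x}. k \<le> l} = {l\<in>T. k \<le> l}"
  by auto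

text \<open>
  Since \<open>h\<close> is the mass function of \<open>\<nu>\<close>, one of the two factors \<open>h x\<close> on the left can be written as a
  sum of \<open>\<nu> b\<close> over the boundary nodes below \<open>x\<close>. Exchanging the sums turns the left side into a
  \<open>\<nu>\<close>-weighted sum of chain sums, to which Hardy's inequality applies, and reversing the exchange
  returns the factor \<open>h\<close>.
\<close>
lemma tree_hardy_inequality:
  fixes f h H \<nu> :: "'a \<Rightarrow> real"
  assumes \<nu>: "\<And>b. b \<in> L \<Longrightarrow> 0 \<le> \<nu> b"
    and h: "\<And>x. x \<in> T \<Longrightarrow> h x = (\<Sum>b\<in>{b\<in>L. b \<le> x}. \<nu> b)"
    and H: "\<And>x. x \<in> T \<Longrightarrow> H x = (\<Sum>y\<in>{y\<in>T. x \<le> y}. h y)"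
    and supp: "\<And>x. x \<in> T \<Longrightarrow> h x = 0 \<Longrightarrow> f x = 0" and eta: "0 < \<eta>"
  shows "(\<Sum>x\<in>T. (h x * (\<Sum>y\<in>{y\<in>T. x \<le> y \<and> H y \<le> \<eta> * H x}. f y) / H x)\<^sup>2)
      \<le> 6 * \<eta> * (\<Sum>x\<in>T. (f x)\<^sup>2)"
proof -
  have h0: "0 \<le> h x" if "x \<in> T" for x
    using h[OF that] \<nu> by (auto intro: sum_nonneg)
  define q where "q x = ((\<Sum>y\<in>{y\<in>T. x \<le> y \<and> H y \<le> \<eta> * H x}. f y) / H x)\<^sup>2" for x
  have chainwise: "(\<Sum>x\<in>{x\<in>T. b \<le> x}. h x * q x) \<le> 6 * \<eta> * (\<Sum>x\<in>{x\<in>T. b \<le> x}. (f x)\<^sup>2 / h x)"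
    if b: "b \<in> L" for b
  proof -
    let ?A = "{x\<in>T. b \<le> x}"
    have HA: "(\<Sum>l\<in>{l\<in>?A. x \<le> l}. h l) = H x" if "x \<in> ?A" for x
      using H that ancestors_of_ancestor[of b x] by simp
    have "(\<Sum>x\<in>?A. h x * q x) = (\<Sum>k\<in>?A. h k * ((\<Sum>i\<in>{i\<in>?A. k \<le> i \<and>
        (\<Sum>l\<in>{l\<in>?A. i \<le> l}. h l) \<le> \<eta> * (\<Sum>l\<in>{l\<in>?A. k \<le> l}. h l)}. f i) / (\<Sum>l\<in>{l\<in>?A. k \<le> l}. h l))\<^sup>2)"
    proof (intro sum.cong refl)
      fix k assume k: "k \<in> ?A"
      have "{i\<in>?A. k \<le> i \<and> (\<Sum>l\<in>{l\<in>?A. i \<le> l}. h l) \<le> \<eta> * (\<Sum>l\<in>{l\<in>?A. k \<le> l}. h l)}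
          = {y\<in>T. k \<le> y \<and> H y \<le> \<eta> * H k}"
        unfolding HA[OF k] using k HA by auto
      then show "h k * q k = h k * ((\<Sum>i\<in>{i\<in>?A. k \<le> i \<and>
        (\<Sum>l\<in>{l\<in>?A. i \<le> l}. h l) \<le> \<eta> * (\<Sum>l\<in>{l\<in>?A. k \<le> l}. h l)}. f i) / (\<Sum>l\<in>{l\<in>?A. k \<le> l}. h l))\<^sup>2"
        unfolding q_def HA[OF k] by simp
    qed
    also have "\<dots> \<le> 6 * \<eta> * (\<Sum>x\<in>?A. (f x)\<^sup>2 / h x)"
      by (rule chain_hardy_inequality) (use finite_T h0 supp eta ancestors_chain[OF b] in auto)
    finally show ?thesis .
  qed
  have "(\<Sum>x\<in>T. (h x * (\<Sum>y\<in>{y\<in>T. x \<le> y \<and> H y \<le> \<eta> * H x}. f y) / H x)\<^sup>2)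
      = (\<Sum>x\<in>T. (\<Sum>b\<in>{b\<in>L. b \<le> x}. \<nu> b) * (h x * q x))"
    by (intro sum.cong refl) (simp add: q_def h power2_eq_square)
  also have "\<dots> = (\<Sum>b\<in>L. \<nu> b * (\<Sum>x\<in>{x\<in>T. b \<le> x}. h x * q x))"
    by (rule sum_incidence_swap[OF finite_T finite_L])
  also have "\<dots> \<le> (\<Sum>b\<in>L. \<nu> b * (6 * \<eta> * (\<Sum>x\<in>{x\<in>T. b \<le> x}. (f x)\<^sup>2 / h x)))"
    by (intro sum_mono mult_left_mono chainwise \<nu>)
  also have "\<dots> = 6 * \<eta> * (\<Sum>b\<in>L. \<nu> b * (\<Sum>x\<in>{x\<in>T. b \<le> x}. (f x)\<^sup>2 / h x))"
    by (simp add: sum_distrib_left mult.left_commute mult.assoc)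
  also have "\<dots> = 6 * \<eta> * (\<Sum>x\<in>T. (\<Sum>b\<in>{b\<in>L. b \<le> x}. \<nu> b) * ((f x)\<^sup>2 / h x))"
    by (subst sum_incidence_swap[OF finite_T finite_L]) (rule refl)
  also have "(\<Sum>x\<in>T. (\<Sum>b\<in>{b\<in>L. b \<le> x}. \<nu> b) * ((f x)\<^sup>2 / h x)) = (\<Sum>x\<in>T. (f x)\<^sup>2)"
    using supp by (intro sum.cong refl) (auto simp flip: h)
  finally show ?thesis .
qed

definition mass :: "('a \<times> 'a \<Rightarrow> real) \<Rightarrow> 'a \<times> 'a \<Rightarrow> real" where
  "mass w \<alpha> = (\<Sum>\<omega>\<in>{\<omega>\<in>L \<times> L. \<omega> \<le> \<alpha>}. w \<omega>)"

definition potential :: "('a \<times> 'a \<Rightarrow> real) \<Rightarrow> 'a \<times> 'a \<Rightarrow> real" where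
  "potential F \<alpha> = (\<Sum>\<beta>\<in>{\<beta>\<in>T \<times> T. \<alpha> \<le> \<beta>}. F \<beta>)"

text \<open>
  For the potential \<open>u\<close> of \<open>F\<close>, this is the increment of \<open>u\<close> in the first coordinate, a discrete
  $\partial_x u$ (compare \<open>potential_column\<close>).
\<close>
definition row_sum :: "('a \<times> 'a \<Rightarrow> real) \<Rightarrow> 'a \<Rightarrow> 'a \<Rightarrow> real" where
  "row_sum F x y = (\<Sum>y'\<in>{y'\<in>T. y \<le> y'}. F (x, y'))"

text \<open>
  A discrete $\partial_y u$, from which the ancestors of comparatively large potential are removed.
\<close>
definition low_column_sum :: "real \<Rightarrow> ('a \<times> 'a \<Rightarrow> real) \<Rightarrow> 'a \<Rightarrow> 'a \<Rightarrow> real" where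
  "low_column_sum \<eta> F x y =
     (\<Sum>x'\<in>{x'\<in>T. x \<le> x' \<and> potential F (x', y) \<le> \<eta> * potential F (x, y)}. F (x', y))"

text \<open>
  The function $\varphi \approx \partial_x u\,\partial_y u/u$. Where the potential vanishes, the quotient is
  $0$; for nonnegative \<open>F\<close> and \<open>(x, y)\<close> in the bi-tree both factors of the numerator vanish there as well.
\<close>
definition majorant :: "real \<Rightarrow> ('a \<times> 'a \<Rightarrow> real) \<Rightarrow> 'a \<times> 'a \<Rightarrow> real" where
  "majorant \<eta> F = (\<lambda>(x, y). row_sum F x y * low_column_sum \<eta> F x y / potential F (x, y))"

lemma mass_nonneg: "(\<And>\<omega>. \<omega> \<in> L \<times> L \<Longrightarrow> 0 \<le> w \<omega>) \<Longrightarrow> 0 \<le> mass w \<alpha>"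
  by (auto simp: mass_def intro!: sum_nonneg)

lemma duality:
  "(\<Sum>\<alpha>\<in>T \<times> T. mass w \<alpha> * F \<alpha>) = (\<Sum>\<omega>\<in>L \<times> L. w \<omega> * potential F \<omega>)"
  unfolding mass_def potential_def
  by (rule sum_incidence_swap) (auto simp: finite_T finite_L)

lemma potential_column: "potential F (x, y) = (\<Sum>x'\<in>{x'\<in>T. x \<le> x'}. row_sum F x' y)"
proof -
  have "{\<beta>\<in>T \<times> T. (x, y) \<le> \<beta>} = {x'\<in>T. x \<le> x'} \<times> {y'\<in>T. y \<le> y'}" by auto
  then show ?thesis
    by (simp add: potential_def row_sum_def sum.cartesian_product)
qed

lemma potential_row: "potential F (x, y) = (\<Sum>y'\<in>{y'\<in>T. y \<le> y'}. \<Sum>x'\<in>{x'\<in>T. x \<le> x'}. F (x', y'))"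
  unfolding potential_column row_sum_def by (rule sum.swap)

lemma mass_iterated:
  "mass w (x, y) = (\<Sum>a\<in>{a\<in>L. a \<le> x}. \<Sum>b\<in>{b\<in>L. b \<le> y}. w (a, b))"
proof -
  have "{\<omega>\<in>L \<times> L. \<omega> \<le> (x, y)} = {a\<in>L. a \<le> x} \<times> {b\<in>L. b \<le> y}" by auto
  then show ?thesis by (simp add: mass_def sum.cartesian_product)
qed

lemma row_sum_nonneg: "(\<And>\<alpha>. 0 \<le> F \<alpha>) \<Longrightarrow> 0 \<le> row_sum F x y"
  by (simp add: row_sum_def sum_nonneg)

lemma potential_nonneg: "(\<And>\<alpha>. 0 \<le> F \<alpha>) \<Longrightarrow> 0 \<le> potential F \<alpha>"
  by (simp add: potential_def sum_nonneg)

lemma potential_antimono: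
  assumes "\<And>\<alpha>. 0 \<le> F \<alpha>" "\<alpha> \<le> \<beta>"
  shows "potential F \<beta> \<le> potential F \<alpha>"
  unfolding potential_def
  using assms finite_T by (intro sum_mono2) (auto intro: order_trans)

lemma majorant_nonneg: "(\<And>\<alpha>. 0 \<le> F \<alpha>) \<Longrightarrow> 0 \<le> majorant \<eta> F \<alpha>"
  by (cases \<alpha>) (simp add: majorant_def low_column_sum_def row_sum_nonneg potential_nonneg sum_nonneg)

text \<open>
  For a fixed second coordinate \<open>y\<close>, the function \<open>x \<mapsto> row_sum (mass w) x y\<close> is the mass function
  of a nonnegative measure on the boundary of the tree and its sums over ancestors are the potential.
  So each column is an instance of Hardy's inequality on the tree.
\<close>
lemma majorant_norm:
  assumes w: "\<And>\<omega>. \<omega> \<in> L \<times> L \<Longrightarrow> 0 \<le> w \<omega>" and eta: "0 < \<eta>"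
  shows "(\<Sum>\<alpha>\<in>T \<times> T. (majorant \<eta> (mass w) \<alpha>)\<^sup>2) \<le> 6 * \<eta> * (\<Sum>\<alpha>\<in>T \<times> T. (mass w \<alpha>)\<^sup>2)"
proof -
  have column: "(\<Sum>x\<in>T. (majorant \<eta> (mass w) (x, y))\<^sup>2) \<le> 6 * \<eta> * (\<Sum>x\<in>T. (mass w (x, y))\<^sup>2)"
    if y: "y \<in> T" for y
    unfolding majorant_def low_column_sum_def case_prod_conv
  proof (rule tree_hardy_inequality)
    show "0 \<le> (\<Sum>y'\<in>{y'\<in>T. y \<le> y'}. \<Sum>b\<in>{b\<in>L. b \<le> y'}. w (a, b))" if "a \<in> L" for a
      using that w by (intro sum_nonneg) auto
    show "row_sum (mass w) x y
        = (\<Sum>a\<in>{a\<in>L. a \<le> x}. \<Sum>y'\<in>{y'\<in>T. y \<le> y'}. \<Sum>b\<in>{b\<in>L. b \<le> y'}. w (a, b))" for x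
      unfolding row_sum_def mass_iterated by (rule sum.swap)
    show "potential (mass w) (x, y) = (\<Sum>x'\<in>{x'\<in>T. x \<le> x'}. row_sum (mass w) x' y)" for x
      by (rule potential_column)
    show "mass w (x, y) = 0" if "row_sum (mass w) x y = 0" for x
    proof -
      have "mass w (x, y) \<le> row_sum (mass w) x y"
        unfolding row_sum_def using y finite_T w by (intro member_le_sum) (auto intro: mass_nonneg)
      then show ?thesis using that mass_nonneg[of w "(x, y)"] w by fastforce
    qed
  qed (rule eta)
  have "(\<Sum>\<alpha>\<in>T \<times> T. (majorant \<eta> (mass w) \<alpha>)\<^sup>2) = (\<Sum>y\<in>T. \<Sum>x\<in>T. (majorant \<eta> (mass w) (x, y))\<^sup>2)"
    by (subst sum.swap) (simp add: sum.cartesian_product)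
  also have "\<dots> \<le> (\<Sum>y\<in>T. 6 * \<eta> * (\<Sum>x\<in>T. (mass w (x, y))\<^sup>2))"
    by (intro sum_mono column)
  also have "\<dots> = 6 * \<eta> * (\<Sum>y\<in>T. \<Sum>x\<in>T. (mass w (x, y))\<^sup>2)" by (simp add: sum_distrib_left)
  also have "\<dots> = 6 * \<eta> * (\<Sum>\<alpha>\<in>T \<times> T. (mass w \<alpha>)\<^sup>2)"
    by (subst sum.swap) (simp add: sum.cartesian_product)
  finally show ?thesis .
qed

text \<open>
  Write \<open>U\<close> for the potential at $\omega = (a, b)$ and sort the ancestors \<open>(x, y)\<close> of \<open>\<omega>\<close> by \<open>y\<close>. The \<open>y\<close> for which
  $u(a, y) \le \eta U$ contribute at most $\eta U$ in total, by the maximum principle for the chain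
  of the \<open>y\<close>. For any other \<open>y\<close>, the increments of the potential at the \<open>x\<close> with
  $u(x, y) \le \eta^2 U$ add up to at most $\eta^2 U < u(a, y)/2$, so at least half of $u(a, y)$ is
  gained where $u(x, y) > \eta^2 U$. At each of these nodes the ancestors with potential at most
  $\eta^3 U$ pass the cut-off in \<open>low_column_sum\<close>. Hence the sum of the majorant over \<open>x\<close> is at
  least half of the sum of \<open>F\<close> that is to be estimated.
\<close>
lemma low_potential_bound:
  assumes F: "\<And>\<alpha>. 0 \<le> F \<alpha>" and \<omega>: "\<omega> \<in> L \<times> L" and eta: "0 < \<eta>" "\<eta> \<le> 1 / 2"
  shows "(\<Sum>\<beta>\<in>{\<beta>\<in>T \<times> T. \<omega> \<le> \<beta> \<and> potential F \<beta> \<le> \<eta> ^ 3 * potential F \<omega>}. F \<beta>)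
      \<le> \<eta> * potential F \<omega> + 2 * potential (majorant \<eta> F) \<omega>"
proof -
  obtain a b where ab: "\<omega> = (a, b)" "a \<in> L" "b \<in> L" using \<omega> by auto
  define A B where "A = {x\<in>T. a \<le> x}" and "B = {y\<in>T. b \<le> y}"
  have fin: "finite A" "finite B" using finite_T by (auto simp: A_def B_def)
  have chainA: "x \<le> x' \<or> x' \<le> x" if "x \<in> A" "x' \<in> A" for x x'
    using that ancestors_chain[OF ab(2), of x x'] by (auto simp: A_def)
  have chainB: "y \<le> y' \<or> y' \<le> y" if "y \<in> B" "y' \<in> B" for y y'
    using that ancestors_chain[OF ab(3), of y y'] by (auto simp: B_def)
  define u where "u x y = potential F (x, y)" for x y
  define U where "U = u a b"
  have u0: "0 \<le> u x y" for x y by (simp add: u_def potential_nonneg F)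
  have U0: "0 \<le> U" by (simp add: U_def u0)
  have u_mono: "u x' y \<le> u x y" if "x \<le> x'" for x x' y
    unfolding u_def using that by (intro potential_antimono F) auto
  define low where "low y = (\<Sum>x\<in>{x\<in>A. u x y \<le> \<eta> ^ 3 * U}. F (x, y))" for y
  have rowsplit: "potential G \<omega> = (\<Sum>y\<in>B. \<Sum>x\<in>A. G (x, y))" for G
    unfolding ab A_def B_def by (rule potential_row)
  have "{\<beta>\<in>T \<times> T. \<omega> \<le> \<beta> \<and> potential F \<beta> \<le> \<eta> ^ 3 * potential F \<omega>} = {\<beta>\<in>A \<times> B. u (fst \<beta>) (snd \<beta>) \<le> \<eta> ^ 3 * U}"
    by (auto simp: A_def B_def u_def U_def ab)
  then have "(\<Sum>\<beta>\<in>{\<beta>\<in>T \<times> T. \<omega> \<le> \<beta> \<and> potential F \<beta> \<le> \<eta> ^ 3 * potential F \<omega>}. F \<beta>)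
      = (\<Sum>\<beta>\<in>A \<times> B. if u (fst \<beta>) (snd \<beta>) \<le> \<eta> ^ 3 * U then F \<beta> else 0)"
    using fin by (simp add: sum.inter_filter)
  also have "\<dots> = (\<Sum>x\<in>A. \<Sum>y\<in>B. if u x y \<le> \<eta> ^ 3 * U then F (x, y) else 0)"
    unfolding sum.cartesian_product by (intro sum.cong) (auto split: prod.split)
  also have "\<dots> = (\<Sum>y\<in>B. low y)"
    unfolding low_def sum.inter_filter[OF fin(1)] by (rule sum.swap)
  also have "\<dots> = (\<Sum>y\<in>{y\<in>B. u a y \<le> \<eta> * U}. low y) + (\<Sum>y\<in>{y\<in>B. \<not> u a y \<le> \<eta> * U}. low y)"
    using fin by (subst sum.union_disjoint[symmetric]) (auto intro!: sum.cong)
  also have "(\<Sum>y\<in>{y\<in>B. u a y \<le> \<eta> * U}. low y) \<le> \<eta> * U"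
  proof -
    let ?h = "\<lambda>y. \<Sum>x\<in>A. F (x, y)"
    have level_set: "{y\<in>B. u a y \<le> \<eta> * U} = {y\<in>B. (\<Sum>l\<in>{l\<in>B. y \<le> l}. ?h l) \<le> \<eta> * U}"
    proof -
      have "(\<Sum>l\<in>{l\<in>B. y \<le> l}. ?h l) = u a y" if "y \<in> B" for y
      proof -
        have "{l\<in>B. y \<le> l} = {l\<in>T. y \<le> l}" using that by (auto simp: B_def)
        then show ?thesis by (simp add: u_def potential_row A_def)
      qed
      then show ?thesis by auto
    qed
    have "(\<Sum>y\<in>{y\<in>B. u a y \<le> \<eta> * U}. low y) \<le> (\<Sum>y\<in>{y\<in>B. u a y \<le> \<eta> * U}. ?h y)"
      unfolding low_def using fin F by (intro sum_mono sum_mono2) auto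
    also have "\<dots> \<le> \<eta> * U"
      unfolding level_set
      using fin F U0 eta by (intro chain_sum_below chainB sum_nonneg) auto
    finally show ?thesis .
  qed
  also have "(\<Sum>y\<in>{y\<in>B. \<not> u a y \<le> \<eta> * U}. low y) \<le> (\<Sum>y\<in>{y\<in>B. \<not> u a y \<le> \<eta> * U}. 2 * (\<Sum>x\<in>A. majorant \<eta> F (x, y)))"
  proof (rule sum_mono)
    fix y assume "y \<in> {y\<in>B. \<not> u a y \<le> \<eta> * U}"
    then have y: "y \<in> B" "\<eta> * U < u a y" by auto
    then have pos: "0 < u a y" using U0 eta by (meson le_less_trans mult_nonneg_nonneg less_imp_le)
    let ?r = "\<lambda>x. row_sum F x y"
    have r0: "0 \<le> ?r x" for x by (simp add: row_sum_nonneg F)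
    have u_eq: "u x y = (\<Sum>l\<in>{l\<in>A. x \<le> l}. ?r l)" if "x \<in> A" for x
    proof -
      have "{l\<in>A. x \<le> l} = {l\<in>T. x \<le> l}" using that by (auto simp: A_def)
      then show ?thesis by (simp add: u_def potential_column)
    qed
    have total: "sum ?r A = u a y" by (simp add: u_def potential_column A_def)
    have low0: "0 \<le> low y" by (simp add: low_def F sum_nonneg)
    define S where "S = {x\<in>A. \<not> u x y \<le> \<eta>\<^sup>2 * U}"
    have "(\<Sum>x\<in>{x\<in>A. (\<Sum>l\<in>{l\<in>A. x \<le> l}. ?r l) \<le> \<eta>\<^sup>2 * U}. ?r x) \<le> \<eta>\<^sup>2 * U"
      using fin r0 U0 by (intro chain_sum_below chainA) auto
    moreover have "{x\<in>A. (\<Sum>l\<in>{l\<in>A. x \<le> l}. ?r l) \<le> \<eta>\<^sup>2 * U} = {x\<in>A. u x y \<le> \<eta>\<^sup>2 * U}"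
      using u_eq by auto
    moreover have "sum ?r A = (\<Sum>x\<in>{x\<in>A. u x y \<le> \<eta>\<^sup>2 * U}. ?r x) + sum ?r S"
      unfolding S_def using fin by (subst sum.union_disjoint[symmetric]) (auto intro!: sum.cong)
    moreover have "\<eta>\<^sup>2 * U \<le> \<eta> * u a y"
      using y eta by (simp add: power2_eq_square mult.assoc)
    moreover have "\<eta> * u a y \<le> 1 / 2 * u a y" using eta pos by (intro mult_right_mono) auto
    ultimately have S: "u a y / 2 \<le> sum ?r S" using total by simp
    have maj: "?r x * low y / u a y \<le> majorant \<eta> F (x, y)" if x: "x \<in> S" for x
    proof -
      have xA: "x \<in> A" and ux: "\<eta>\<^sup>2 * U < u x y" using x by (auto simp: S_def)
      have uxpos: "0 < u x y" using ux U0 by (meson le_less_trans mult_nonneg_nonneg zero_le_power2)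
      have "low y \<le> low_column_sum \<eta> F x y"
        unfolding low_def low_column_sum_def
      proof (rule sum_mono2)
        show "{x'\<in>A. u x' y \<le> \<eta> ^ 3 * U} \<subseteq> {x'\<in>T. x \<le> x' \<and> potential F (x', y) \<le> \<eta> * potential F (x, y)}"
        proof
          fix x' assume "x' \<in> {x'\<in>A. u x' y \<le> \<eta> ^ 3 * U}"
          then have x': "x' \<in> A" "u x' y \<le> \<eta> ^ 3 * U" by auto
          have le: "u x' y \<le> \<eta> * u x y"
          proof -
            have "\<eta> ^ 3 * U = \<eta> * (\<eta>\<^sup>2 * U)" by (simp add: power2_eq_square power3_eq_cube)
            also have "\<dots> \<le> \<eta> * u x y" using ux eta by (intro mult_left_mono) auto
            finally show ?thesis using x' by simp
          qed
          have "x \<le> x'"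
          proof (rule ccontr)
            assume "\<not> x \<le> x'"
            then have "x' \<le> x" using chainA[OF xA x'(1)] by simp
            then have "u x y \<le> u x' y" by (rule u_mono)
            moreover have "\<eta> * u x y \<le> 1 / 2 * u x y" using eta uxpos by (intro mult_right_mono) auto
            ultimately show False using le uxpos by simp
          qed
          then show "x' \<in> {x'\<in>T. x \<le> x' \<and> potential F (x', y) \<le> \<eta> * potential F (x, y)}"
            using x' le by (auto simp: A_def u_def)
        qed
      qed (use finite_T F in auto)
      moreover have "u x y \<le> u a y" using xA by (intro u_mono) (auto simp: A_def)
      ultimately have "?r x * low y / u a y \<le> ?r x * low_column_sum \<eta> F x y / u x y"
        using uxpos r0 low0 by (intro frac_le mult_left_mono mult_nonneg_nonneg) auto
      then show ?thesis by (simp add: majorant_def u_def)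
    qed
    have "low y = 2 * (u a y / 2 * (low y / u a y))" using pos by simp
    also have "\<dots> \<le> 2 * (sum ?r S * (low y / u a y))"
      using S low0 pos by (intro mult_left_mono mult_right_mono) auto
    also have "sum ?r S * (low y / u a y) = (\<Sum>x\<in>S. ?r x * low y / u a y)"
      by (simp add: sum_distrib_right sum_divide_distrib)
    also have "\<dots> \<le> (\<Sum>x\<in>S. majorant \<eta> F (x, y))" by (rule sum_mono[OF maj])
    also have "\<dots> \<le> (\<Sum>x\<in>A. majorant \<eta> F (x, y))"
      using fin F by (intro sum_mono2) (auto simp: S_def intro: majorant_nonneg)
    finally show "low y \<le> 2 * (\<Sum>x\<in>A. majorant \<eta> F (x, y))" by simp
  qed
  also have "\<dots> \<le> (\<Sum>y\<in>B. 2 * (\<Sum>x\<in>A. majorant \<eta> F (x, y)))"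
    using fin F by (intro sum_mono2) (auto intro!: sum_nonneg majorant_nonneg)
  also have "\<dots> = 2 * potential (majorant \<eta> F) \<omega>"
    by (simp add: rowsplit sum_distrib_left)
  finally show ?thesis by (simp add: U_def u_def ab)
qed

section \<open>From the Carleson condition to the embedding\<close>

text \<open>
  The Carleson condition in terms of the order alone; for the dyadic bi-tree, \<open>rects_inside_eq\<close>
  identifies the index set of the sum with the rectangles inside \<open>E\<close>.
\<close>
definition carleson_box :: "('a \<times> 'a \<Rightarrow> real) \<Rightarrow> real \<Rightarrow> bool" where
  "carleson_box \<mu> C \<longleftrightarrow> (\<forall>E\<subseteq>L \<times> L.
     (\<Sum>\<alpha>\<in>{\<alpha>\<in>T \<times> T. \<forall>\<omega>\<in>L \<times> L. \<omega> \<le> \<alpha> \<longrightarrow> \<omega> \<in> E}. (mass \<mu> \<alpha>)\<^sup>2) \<le> C * sum \<mu> E)"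

definition mass_embedding :: "('a \<times> 'a \<Rightarrow> real) \<Rightarrow> real \<Rightarrow> bool" where
  "mass_embedding \<mu> \<Lambda> \<longleftrightarrow> (\<forall>\<psi>. (\<forall>\<omega>. 0 \<le> \<psi> \<omega>) \<longrightarrow>
     (\<Sum>\<alpha>\<in>T \<times> T. (mass (\<lambda>\<omega>. \<psi> \<omega> * \<mu> \<omega>) \<alpha>)\<^sup>2) \<le> \<Lambda> * (\<Sum>\<omega>\<in>L \<times> L. (\<psi> \<omega>)\<^sup>2 * \<mu> \<omega>))"

text \<open>
  If $u(\alpha)^2 \ge t$, then the boundary nodes below \<open>\<alpha>\<close> all lie in the level set
  $\{u^2 \ge t\}$, so the Carleson condition for this set controls the nodes of the bi-tree on the same level.
\<close>
lemma carleson_level_sets: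
  assumes carl: "carleson_box \<mu> C" and C: "0 \<le> C"
    and \<mu>: "\<And>\<omega>. \<omega> \<in> L \<times> L \<Longrightarrow> 0 \<le> \<mu> \<omega>"
    and u: "\<And>\<alpha>. 0 \<le> u \<alpha>" and mono: "\<And>\<alpha> \<beta>. \<alpha> \<le> \<beta> \<Longrightarrow> u \<beta> \<le> u \<alpha>"
  shows "(\<Sum>\<alpha>\<in>T \<times> T. (mass \<mu> \<alpha>)\<^sup>2 * (u \<alpha>)\<^sup>2) \<le> C * (\<Sum>\<omega>\<in>L \<times> L. \<mu> \<omega> * (u \<omega>)\<^sup>2)"
proof (rule layer_cake_comparison)
  fix t :: real
  define E where "E = {\<omega>\<in>L \<times> L. t \<le> (u \<omega>)\<^sup>2}"
  have "(\<Sum>\<alpha>\<in>{\<alpha>\<in>T \<times> T. t \<le> (u \<alpha>)\<^sup>2}. (mass \<mu> \<alpha>)\<^sup>2)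
      \<le> (\<Sum>\<alpha>\<in>{\<alpha>\<in>T \<times> T. \<forall>\<omega>\<in>L \<times> L. \<omega> \<le> \<alpha> \<longrightarrow> \<omega> \<in> E}. (mass \<mu> \<alpha>)\<^sup>2)"
  proof (rule sum_mono2)
    show "{\<alpha>\<in>T \<times> T. t \<le> (u \<alpha>)\<^sup>2} \<subseteq> {\<alpha>\<in>T \<times> T. \<forall>\<omega>\<in>L \<times> L. \<omega> \<le> \<alpha> \<longrightarrow> \<omega> \<in> E}"
      unfolding E_def using power_mono[OF mono u, of _ _ 2] by (blast intro: order_trans)
  qed (use finite_T in auto)
  also have "\<dots> \<le> C * sum \<mu> E"
  proof -
    have "E \<subseteq> L \<times> L" unfolding E_def by blast
    then show ?thesis using carl unfolding carleson_box_def by (elim allE) (erule mp)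
  qed
  finally show "(\<Sum>\<alpha>\<in>{\<alpha>\<in>T \<times> T. t \<le> (u \<alpha>)\<^sup>2}. (mass \<mu> \<alpha>)\<^sup>2) \<le> C * (\<Sum>\<omega>\<in>{\<omega>\<in>L \<times> L. t \<le> (u \<omega>)\<^sup>2}. \<mu> \<omega>)"
    unfolding E_def .
qed (use finite_T finite_L C \<mu> in auto)

text \<open>
  Duality and the Cauchy--Schwarz inequality: the left side \<open>S\<close> is the pairing of \<open>F\<close> with the mass function of \<open>potential F \<cdot> \<mu>\<close>, whose
  squared norm is at most \<open>\<Lambda> S\<close> by hypothesis.
\<close>
lemma potential_embedding:
  assumes emb: "mass_embedding \<mu> \<Lambda>" and \<Lambda>: "0 \<le> \<Lambda>" and F: "\<And>\<alpha>. 0 \<le> F \<alpha>"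
    and \<mu>: "\<And>\<omega>. \<omega> \<in> L \<times> L \<Longrightarrow> 0 \<le> \<mu> \<omega>"
  shows "(\<Sum>\<omega>\<in>L \<times> L. (potential F \<omega>)\<^sup>2 * \<mu> \<omega>) \<le> \<Lambda> * (\<Sum>\<alpha>\<in>T \<times> T. (F \<alpha>)\<^sup>2)"
proof -
  let ?S = "\<Sum>\<omega>\<in>L \<times> L. (potential F \<omega>)\<^sup>2 * \<mu> \<omega>"
  let ?m = "mass (\<lambda>\<omega>. potential F \<omega> * \<mu> \<omega>)"
  have S0: "0 \<le> ?S" using \<mu> by (intro sum_nonneg) auto
  have emb': "(\<Sum>\<alpha>\<in>T \<times> T. (?m \<alpha>)\<^sup>2) \<le> \<Lambda> * ?S"
    using emb potential_nonneg[of F] F unfolding mass_embedding_def by blast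
  have "?S = (\<Sum>\<omega>\<in>L \<times> L. (potential F \<omega> * \<mu> \<omega>) * potential F \<omega>)"
    by (intro sum.cong refl) (simp add: power2_eq_square)
  also have "\<dots> = (\<Sum>\<alpha>\<in>T \<times> T. ?m \<alpha> * F \<alpha>)"
    by (simp add: duality)
  finally have "?S\<^sup>2 \<le> (\<Sum>\<alpha>\<in>T \<times> T. (?m \<alpha>)\<^sup>2) * (\<Sum>\<alpha>\<in>T \<times> T. (F \<alpha>)\<^sup>2)"
    using Cauchy_Schwarz_ineq_sum[of ?m F "T \<times> T"] by (simp only:)
  also have "\<dots> \<le> (\<Lambda> * ?S) * (\<Sum>\<alpha>\<in>T \<times> T. (F \<alpha>)\<^sup>2)"
    by (intro mult_right_mono emb' sum_nonneg) auto
  finally have *: "?S * ?S \<le> ?S * (\<Lambda> * (\<Sum>\<alpha>\<in>T \<times> T. (F \<alpha>)\<^sup>2))"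
    by (simp add: power2_eq_square algebra_simps)
  show ?thesis
  proof (cases "?S = 0")
    case False
    then show ?thesis using * S0 by (simp add: mult_le_cancel_left)
  next
    case True
    then show ?thesis using \<Lambda> by (simp add: sum_nonneg)
  qed
qed

text \<open>
  The step that uses the Carleson condition: the splitting of the energy into three parts described at the
  beginning, with $\eta = 1/600$ and $\varepsilon = \eta^3$. The last two parts are at most a quarter of
  the energy each. The constant $256 \cdot 600^6 = 256/\varepsilon^2$ is what the middle part requires.
\<close>
lemma embedding_halving:
  assumes carl: "carleson_box \<mu> C" and C: "0 \<le> C"
    and \<mu>: "\<And>\<omega>. \<omega> \<in> L \<times> L \<Longrightarrow> 0 \<le> \<mu> \<omega>"
    and emb: "mass_embedding \<mu> \<Lambda>" and \<Lambda>: "0 < \<Lambda>" "256 * 600 ^ 6 * C \<le> \<Lambda>"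
  shows "mass_embedding \<mu> (\<Lambda> / 2)"
  unfolding mass_embedding_def
proof (intro allI impI)
  fix \<psi> :: "'a \<times> 'a \<Rightarrow> real" assume "\<forall>\<omega>. 0 \<le> \<psi> \<omega>"
  then have \<psi>: "0 \<le> \<psi> \<omega>" for \<omega> by blast
  define w where "w \<omega> = \<psi> \<omega> * \<mu> \<omega>" for \<omega>
  define f where "f = mass w"
  define u where "u = potential f"
  define \<eta> :: real where "\<eta> = 1 / 600"
  define \<epsilon> where "\<epsilon> = \<eta> ^ 3"
  define \<Psi> where "\<Psi> = (\<Sum>\<omega>\<in>L \<times> L. (\<psi> \<omega>)\<^sup>2 * \<mu> \<omega>)"
  define En where "En = (\<Sum>\<alpha>\<in>T \<times> T. (f \<alpha>)\<^sup>2)"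
  have eta: "0 < \<eta>" "\<eta> \<le> 1 / 2" and eps: "0 < \<epsilon>" by (auto simp: \<eta>_def \<epsilon>_def)
  have w: "0 \<le> w \<omega>" if "\<omega> \<in> L \<times> L" for \<omega> using that \<psi> \<mu> by (simp add: w_def)
  have f: "0 \<le> f \<alpha>" for \<alpha> unfolding f_def by (rule mass_nonneg[OF w])
  have u: "0 \<le> u \<alpha>" for \<alpha> unfolding u_def by (rule potential_nonneg[OF f])
  have En0: "0 \<le> En" by (simp add: En_def sum_nonneg)
  have fin: "finite (T \<times> T)" "finite (L \<times> L)" using finite_T finite_L by auto
  define low where "low \<omega> = (\<Sum>\<beta>\<in>{\<beta>\<in>T \<times> T. \<omega> \<le> \<beta> \<and> u \<beta> \<le> \<epsilon> * u \<omega>}. f \<beta>)" for \<omega>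
  (* The factor that compares psi at a boundary node with u at an ancestor where u is larger than epsilon times its value at that node. *)
  define k where "k = 4 / (\<Lambda> * \<epsilon>)"
  have k: "0 < k" using \<Lambda> eps by (simp add: k_def)
  have pointwise: "w \<omega> * u \<omega> \<le> \<Lambda> / 4 * ((\<psi> \<omega>)\<^sup>2 * \<mu> \<omega>) + w \<omega> * low \<omega> + k * (\<mu> \<omega> * potential (\<lambda>\<beta>. f \<beta> * u \<beta>) \<omega>)"
    if \<omega>: "\<omega> \<in> L \<times> L" for \<omega>
  proof -
    have t1: "0 \<le> \<Lambda> / 4 * ((\<psi> \<omega>)\<^sup>2 * \<mu> \<omega>)" using \<Lambda> \<mu>[OF \<omega>] by simp
    have t2: "0 \<le> w \<omega> * low \<omega>" using w[OF \<omega>] f by (simp add: low_def sum_nonneg)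
    have t3: "0 \<le> k * (\<mu> \<omega> * potential (\<lambda>\<beta>. f \<beta> * u \<beta>) \<omega>)"
      using k \<mu>[OF \<omega>] f u by (simp add: potential_nonneg)
    show ?thesis
    proof (cases "u \<omega> \<le> \<Lambda> / 4 * \<psi> \<omega>")
      case True
      have "w \<omega> * u \<omega> \<le> w \<omega> * (\<Lambda> / 4 * \<psi> \<omega>)" by (intro mult_left_mono True w \<omega>)
      also have "\<dots> = \<Lambda> / 4 * ((\<psi> \<omega>)\<^sup>2 * \<mu> \<omega>)" by (simp add: w_def power2_eq_square)
      finally show ?thesis using t2 t3 by linarith
    next
      case False
      let ?hi = "{\<beta>\<in>T \<times> T. \<omega> \<le> \<beta> \<and> \<not> u \<beta> \<le> \<epsilon> * u \<omega>}"
      have split: "u \<omega> = low \<omega> + (\<Sum>\<beta>\<in>?hi. f \<beta>)"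
        unfolding low_def u_def potential_def
        using fin by (subst sum.union_disjoint[symmetric]) (auto intro!: sum.cong)
      have "\<psi> \<omega> * (\<Sum>\<beta>\<in>?hi. f \<beta>) = (\<Sum>\<beta>\<in>?hi. f \<beta> * \<psi> \<omega>)"
        by (simp add: sum_distrib_left mult.commute)
      also have "\<dots> \<le> (\<Sum>\<beta>\<in>?hi. k * (f \<beta> * u \<beta>))"
      proof (rule sum_mono)
        fix \<beta> assume "\<beta> \<in> ?hi"
        then have "\<epsilon> * u \<omega> < u \<beta>" by auto
        then have "u \<omega> \<le> u \<beta> / \<epsilon>" using eps by (simp add: field_simps)
        moreover have "\<psi> \<omega> \<le> 4 / \<Lambda> * u \<omega>" using False \<Lambda> by (simp add: field_simps)
        ultimately have "\<psi> \<omega> \<le> 4 / \<Lambda> * (u \<beta> / \<epsilon>)"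
          using \<Lambda> by (meson divide_nonneg_pos mult_left_mono order_trans zero_le_numeral)
        then have "f \<beta> * \<psi> \<omega> \<le> f \<beta> * (4 / \<Lambda> * (u \<beta> / \<epsilon>))" by (intro mult_left_mono f)
        then show "f \<beta> * \<psi> \<omega> \<le> k * (f \<beta> * u \<beta>)" by (simp add: k_def ac_simps)
      qed
      also have "\<dots> \<le> k * potential (\<lambda>\<beta>. f \<beta> * u \<beta>) \<omega>"
        unfolding potential_def sum_distrib_left using fin f u k by (intro sum_mono2) auto
      finally have "\<mu> \<omega> * (\<psi> \<omega> * (\<Sum>\<beta>\<in>?hi. f \<beta>)) \<le> \<mu> \<omega> * (k * potential (\<lambda>\<beta>. f \<beta> * u \<beta>) \<omega>)"
        by (intro mult_left_mono \<mu> \<omega>)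
      moreover have "w \<omega> * u \<omega> = w \<omega> * low \<omega> + \<mu> \<omega> * (\<psi> \<omega> * (\<Sum>\<beta>\<in>?hi. f \<beta>))"
      proof -
        have "w \<omega> * u \<omega> = w \<omega> * (low \<omega> + (\<Sum>\<beta>\<in>?hi. f \<beta>))" by (rule arg_cong[OF split])
        then show ?thesis by (simp only: w_def distrib_left ac_simps)
      qed
      ultimately show ?thesis using t1 by (simp add: ac_simps)
    qed
  qed
  have energy: "En = (\<Sum>\<omega>\<in>L \<times> L. w \<omega> * u \<omega>)"
    unfolding En_def u_def duality[symmetric] by (simp add: f_def power2_eq_square)
  have low_part: "(\<Sum>\<omega>\<in>L \<times> L. w \<omega> * low \<omega>) \<le> En / 4"
  proof -
    let ?\<phi> = "majorant \<eta> f"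
    have "(\<Sum>\<omega>\<in>L \<times> L. w \<omega> * low \<omega>) \<le> (\<Sum>\<omega>\<in>L \<times> L. w \<omega> * (\<eta> * u \<omega> + 2 * potential ?\<phi> \<omega>))"
      unfolding low_def u_def \<epsilon>_def by (intro sum_mono mult_left_mono low_potential_bound f eta w)
    also have "\<dots> = \<eta> * En + 2 * (\<Sum>\<omega>\<in>L \<times> L. w \<omega> * potential ?\<phi> \<omega>)"
      unfolding energy by (simp add: sum.distrib sum_distrib_left algebra_simps)
    also have "(\<Sum>\<omega>\<in>L \<times> L. w \<omega> * potential ?\<phi> \<omega>) = (\<Sum>\<alpha>\<in>T \<times> T. f \<alpha> * ?\<phi> \<alpha>)"
      by (simp add: f_def duality)
    (* These weights make the total eta + 2 (1/20 + 30 eta), which is below 1/4 for eta = 1/600. *)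
    also have "\<dots> \<le> (\<Sum>\<alpha>\<in>T \<times> T. (f \<alpha>)\<^sup>2 / 20 + 5 * (?\<phi> \<alpha>)\<^sup>2)"
    proof (rule sum_mono)
      fix \<alpha>
      have "0 \<le> (f \<alpha> - 10 * ?\<phi> \<alpha>)\<^sup>2" by simp
      then show "f \<alpha> * ?\<phi> \<alpha> \<le> (f \<alpha>)\<^sup>2 / 20 + 5 * (?\<phi> \<alpha>)\<^sup>2"
        by (simp add: power2_eq_square algebra_simps)
    qed
    also have "\<dots> = En / 20 + 5 * (\<Sum>\<alpha>\<in>T \<times> T. (?\<phi> \<alpha>)\<^sup>2)"
      by (simp add: En_def sum.distrib sum_distrib_left sum_divide_distrib)
    also have "(\<Sum>\<alpha>\<in>T \<times> T. (?\<phi> \<alpha>)\<^sup>2) \<le> 6 * \<eta> * En"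
      unfolding En_def f_def by (rule majorant_norm[OF w eta(1)])
    finally show ?thesis using En0 by (simp add: \<eta>_def)
  qed
  have high_part: "(\<Sum>\<omega>\<in>L \<times> L. k * (\<mu> \<omega> * potential (\<lambda>\<beta>. f \<beta> * u \<beta>) \<omega>)) \<le> En / 4"
  proof -
    have "(\<Sum>\<omega>\<in>L \<times> L. k * (\<mu> \<omega> * potential (\<lambda>\<beta>. f \<beta> * u \<beta>) \<omega>))
        = (\<Sum>\<alpha>\<in>T \<times> T. k * (mass \<mu> \<alpha> * (f \<alpha> * u \<alpha>)))"
      by (simp add: sum_distrib_left[symmetric] duality)
    also have "\<dots> \<le> (\<Sum>\<alpha>\<in>T \<times> T. (f \<alpha>)\<^sup>2 / 8 + 2 * k\<^sup>2 * ((mass \<mu> \<alpha>)\<^sup>2 * (u \<alpha>)\<^sup>2))"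
    proof (rule sum_mono)
      fix \<alpha>
      have "0 \<le> (f \<alpha> - 4 * (k * (mass \<mu> \<alpha> * u \<alpha>)))\<^sup>2" by simp
      then show "k * (mass \<mu> \<alpha> * (f \<alpha> * u \<alpha>)) \<le> (f \<alpha>)\<^sup>2 / 8 + 2 * k\<^sup>2 * ((mass \<mu> \<alpha>)\<^sup>2 * (u \<alpha>)\<^sup>2)"
        by (simp add: power2_eq_square algebra_simps)
    qed
    also have "\<dots> = En / 8 + 2 * k\<^sup>2 * (\<Sum>\<alpha>\<in>T \<times> T. (mass \<mu> \<alpha>)\<^sup>2 * (u \<alpha>)\<^sup>2)"
      by (simp add: En_def sum.distrib sum_distrib_left sum_divide_distrib)
    also have "(\<Sum>\<alpha>\<in>T \<times> T. (mass \<mu> \<alpha>)\<^sup>2 * (u \<alpha>)\<^sup>2) \<le> C * (\<Sum>\<omega>\<in>L \<times> L. \<mu> \<omega> * (u \<omega>)\<^sup>2)"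
      using u potential_antimono[OF f] by (intro carleson_level_sets carl C \<mu>) (auto simp: u_def)
    also have "(\<Sum>\<omega>\<in>L \<times> L. \<mu> \<omega> * (u \<omega>)\<^sup>2) \<le> \<Lambda> * En"
      unfolding En_def u_def using potential_embedding[OF emb _ f \<mu>] \<Lambda> by (simp add: mult.commute)
    also have "2 * k\<^sup>2 * (C * (\<Lambda> * En)) \<le> En / 8"
    proof -
      have "2 * k\<^sup>2 * (C * (\<Lambda> * En)) = (32 * 600 ^ 6 * C) / \<Lambda> * En"
        using \<Lambda> by (simp add: k_def \<epsilon>_def \<eta>_def power2_eq_square field_simps)
      also have "\<dots> \<le> 1 / 8 * En"
        using \<Lambda> by (intro mult_right_mono En0) (simp add: divide_le_eq)
      finally show ?thesis by simp
    qed
    finally show ?thesis using C k by (simp add: mult_left_mono)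
  qed
  have "En \<le> (\<Sum>\<omega>\<in>L \<times> L. \<Lambda> / 4 * ((\<psi> \<omega>)\<^sup>2 * \<mu> \<omega>) + w \<omega> * low \<omega> + k * (\<mu> \<omega> * potential (\<lambda>\<beta>. f \<beta> * u \<beta>) \<omega>))"
    unfolding energy by (rule sum_mono[OF pointwise])
  also have "\<dots> = \<Lambda> / 4 * \<Psi> + (\<Sum>\<omega>\<in>L \<times> L. w \<omega> * low \<omega>) + (\<Sum>\<omega>\<in>L \<times> L. k * (\<mu> \<omega> * potential (\<lambda>\<beta>. f \<beta> * u \<beta>) \<omega>))"
    by (simp add: sum.distrib sum_distrib_left \<Psi>_def)
  also have "\<dots> \<le> \<Lambda> / 4 * \<Psi> + En / 4 + En / 4" using low_part high_part by linarith
  finally have "En \<le> \<Lambda> / 2 * \<Psi>" by linarith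
  then show "(\<Sum>\<alpha>\<in>T \<times> T. (mass (\<lambda>\<omega>. \<psi> \<omega> * \<mu> \<omega>) \<alpha>)\<^sup>2) \<le> \<Lambda> / 2 * (\<Sum>\<omega>\<in>L \<times> L. (\<psi> \<omega>)\<^sup>2 * \<mu> \<omega>)"
    by (simp add: En_def f_def \<Psi>_def w_def[abs_def])
qed

lemma mass_embedding_mono:
  assumes emb: "mass_embedding \<mu> \<Lambda>" and le: "\<Lambda> \<le> \<Lambda>'" and \<mu>: "\<And>\<omega>. \<omega> \<in> L \<times> L \<Longrightarrow> 0 \<le> \<mu> \<omega>"
  shows "mass_embedding \<mu> \<Lambda>'"
  unfolding mass_embedding_def
proof (intro allI impI)
  fix \<psi> :: "'a \<times> 'a \<Rightarrow> real" assume "\<forall>\<omega>. 0 \<le> \<psi> \<omega>"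
  then have "(\<Sum>\<alpha>\<in>T \<times> T. (mass (\<lambda>\<omega>. \<psi> \<omega> * \<mu> \<omega>) \<alpha>)\<^sup>2) \<le> \<Lambda> * (\<Sum>\<omega>\<in>L \<times> L. (\<psi> \<omega>)\<^sup>2 * \<mu> \<omega>)"
    using emb unfolding mass_embedding_def by blast
  also have "\<dots> \<le> \<Lambda>' * (\<Sum>\<omega>\<in>L \<times> L. (\<psi> \<omega>)\<^sup>2 * \<mu> \<omega>)"
    using le \<mu> by (intro mult_right_mono sum_nonneg) auto
  finally show "(\<Sum>\<alpha>\<in>T \<times> T. (mass (\<lambda>\<omega>. \<psi> \<omega> * \<mu> \<omega>) \<alpha>)\<^sup>2)
      \<le> \<Lambda>' * (\<Sum>\<omega>\<in>L \<times> L. (\<psi> \<omega>)\<^sup>2 * \<mu> \<omega>)" .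
qed

text \<open>The starting point of the halving: the Cauchy--Schwarz inequality at each node of the finite bi-tree.\<close>
lemma mass_embedding_exists:
  assumes \<mu>: "\<And>\<omega>. \<omega> \<in> L \<times> L \<Longrightarrow> 0 \<le> \<mu> \<omega>"
  shows "mass_embedding \<mu> (\<Sum>\<alpha>\<in>T \<times> T. mass \<mu> \<alpha>)"
  unfolding mass_embedding_def
proof (intro allI impI)
  fix \<psi> :: "'a \<times> 'a \<Rightarrow> real"
  have "(mass (\<lambda>\<omega>. \<psi> \<omega> * \<mu> \<omega>) \<alpha>)\<^sup>2 \<le> mass \<mu> \<alpha> * (\<Sum>\<omega>\<in>L \<times> L. (\<psi> \<omega>)\<^sup>2 * \<mu> \<omega>)" for \<alpha>
  proof -
    have "(mass (\<lambda>\<omega>. \<psi> \<omega> * \<mu> \<omega>) \<alpha>)\<^sup>2 \<le> mass \<mu> \<alpha> * mass (\<lambda>\<omega>. (\<psi> \<omega>)\<^sup>2 * \<mu> \<omega>) \<alpha>"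
      unfolding mass_def using \<mu> by (intro square_sum_le_product) (auto simp: power2_eq_square)
    also have "\<dots> \<le> mass \<mu> \<alpha> * (\<Sum>\<omega>\<in>L \<times> L. (\<psi> \<omega>)\<^sup>2 * \<mu> \<omega>)"
      using \<mu> finite_L by (intro mult_left_mono mass_nonneg) (auto simp: mass_def intro!: sum_mono2)
    finally show ?thesis .
  qed
  then show "(\<Sum>\<alpha>\<in>T \<times> T. (mass (\<lambda>\<omega>. \<psi> \<omega> * \<mu> \<omega>) \<alpha>)\<^sup>2)
      \<le> (\<Sum>\<alpha>\<in>T \<times> T. mass \<mu> \<alpha>) * (\<Sum>\<omega>\<in>L \<times> L. (\<psi> \<omega>)\<^sup>2 * \<mu> \<omega>)"
    unfolding sum_distrib_right by (rule sum_mono)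
qed

text \<open>
  Repeated halving reaches every constant above the threshold, and the threshold itself follows by
  passing to the limit. The limit covers $C = 0$, where halving never stops.
\<close>
theorem carleson_imp_mass_embedding:
  assumes carl: "carleson_box \<mu> C" and C: "0 \<le> C"
    and \<mu>: "\<And>\<omega>. \<omega> \<in> L \<times> L \<Longrightarrow> 0 \<le> \<mu> \<omega>"
  shows "mass_embedding \<mu> (256 * 600 ^ 6 * C)"
proof -
  let ?K = "256 * 600 ^ 6 * C"
  define \<Lambda> where "\<Lambda> = (\<Sum>\<alpha>\<in>T \<times> T. mass \<mu> \<alpha>)"
  have above: "mass_embedding \<mu> t" if t: "?K < t" for t
  proof -
    have t0: "0 < t" 
    proof -
      have "0 \<le> ?K" using C by simp
      then show ?thesis using t by linarith
    qed
    have iterate: "mass_embedding \<mu> (max t (\<Lambda> / 2 ^ n))" for n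
    proof (induction n)
      case 0
      have "mass_embedding \<mu> \<Lambda>" unfolding \<Lambda>_def by (rule mass_embedding_exists[OF \<mu>])
      then show ?case by (rule mass_embedding_mono[OF _ _ \<mu>]) simp
    next
      case (Suc n)
      have "mass_embedding \<mu> (max t (\<Lambda> / 2 ^ n) / 2)"
      proof (rule embedding_halving[OF carl C \<mu> Suc])
        show "0 < max t (\<Lambda> / 2 ^ n)" using t0 by (rule max.strict_coboundedI1)
        show "?K \<le> max t (\<Lambda> / 2 ^ n)" using less_imp_le[OF t] by (rule max.coboundedI1)
      qed
      moreover have "max t (\<Lambda> / 2 ^ n) / 2 \<le> max t (\<Lambda> / 2 ^ Suc n)"
        using t0 by (auto simp: max_def)
      ultimately show ?case by (rule mass_embedding_mono[OF _ _ \<mu>])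
    qed
    obtain n where "\<Lambda> / t < 2 ^ n" using real_arch_pow[of 2 "\<Lambda> / t"] by auto
    then have "\<Lambda> / 2 ^ n < t" using t0 by (simp add: field_simps)
    then show ?thesis using iterate[of n] by (metis max.absorb1 less_imp_le)
  qed
  show ?thesis
    unfolding mass_embedding_def
  proof (intro allI impI)
    fix \<psi> :: "'a \<times> 'a \<Rightarrow> real" assume \<psi>: "\<forall>\<omega>. 0 \<le> \<psi> \<omega>"
    define S where "S = (\<Sum>\<omega>\<in>L \<times> L. (\<psi> \<omega>)\<^sup>2 * \<mu> \<omega>)"
    define En where "En = (\<Sum>\<alpha>\<in>T \<times> T. (mass (\<lambda>\<omega>. \<psi> \<omega> * \<mu> \<omega>) \<alpha>)\<^sup>2)"
    have "En \<le> t * S" if "?K < t" for t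
      using above[OF that] \<psi> unfolding mass_embedding_def En_def S_def by blast
    then have "eventually (\<lambda>t. En \<le> t * S) (at_right ?K)"
      by (auto simp: eventually_at_filter)
    moreover have "((\<lambda>t. t * S) \<longlongrightarrow> ?K * S) (at_right ?K)"
      by (intro tendsto_intros)
    ultimately show "En \<le> ?K * S"
      by (intro tendsto_lowerbound) auto
  qed
qed

end

section \<open>The dyadic bi-tree\<close>

text \<open>
  The intervals are closed, so neighbours share an end point; nestedness needs a common interior
  point \<open>m\<close>.
\<close>
lemma dyadic_interval_nested:
  assumes "k \<le> k'" and "real i / 2 ^ k < m" "m < (real i + 1) / 2 ^ k"
    and "real i' / 2 ^ k' < m" "m < (real i' + 1) / 2 ^ k'"
  shows "dyadic_interval k' i' \<subseteq> dyadic_interval k i"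
proof -
  define d :: nat where "d = 2 ^ (k' - k)"
  have d: "(2::real) ^ k' = 2 ^ k * real d"
    using \<open>k \<le> k'\<close> by (simp add: d_def power_add[symmetric])
  have dpos: "0 < real d" by (simp add: d_def)
  have scale: "z / 2 ^ k = z * real d / 2 ^ k'" for z :: real
    using dpos by (simp add: d)
  have "real i / 2 ^ k < (real i' + 1) / 2 ^ k'" "real i' / 2 ^ k' < (real i + 1) / 2 ^ k"
    using assms by linarith+
  then have "real i * real d < real i' + 1" "real i' < (real i + 1) * real d"
    unfolding scale by (simp_all add: divide_less_cancel)
  then have "real (i * d) < real (i' + 1)" "real i' < real ((i + 1) * d)"
    by (simp_all add: algebra_simps)
  then have "i * d \<le> i'" "i' + 1 \<le> (i + 1) * d" unfolding of_nat_less_iff by linarith+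
  then have "real (i * d) \<le> real i'" "real (i' + 1) \<le> real ((i + 1) * d)"
    by (simp_all only: of_nat_le_iff)
  then have "real i * real d \<le> real i'" "real i' + 1 \<le> (real i + 1) * real d"
    by (simp_all add: algebra_simps)
  then have "real i / 2 ^ k \<le> real i' / 2 ^ k'" "(real i' + 1) / 2 ^ k' \<le> (real i + 1) / 2 ^ k"
    unfolding scale by (simp_all add: divide_right_mono)
  then show ?thesis by (auto simp: dyadic_interval_def)
qed

lemma tree_chain:
  assumes b: "b \<in> tree N" and x: "x \<in> tree N" and y: "y \<in> tree N" and sub: "b \<subseteq> x" "b \<subseteq> y"
  shows "x \<subseteq> y \<or> y \<subseteq> x"
proof -
  obtain l j where l: "b = dyadic_interval l j" using b by (auto simp: tree_def)
  obtain k i where k: "x = dyadic_interval k i" using x by (auto simp: tree_def)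
  obtain k' i' where k': "y = dyadic_interval k' i'" using y by (auto simp: tree_def)
  define m where "m = (real j + 1 / 2) / 2 ^ l"
  have m: "real j / 2 ^ l < m" "m < (real j + 1) / 2 ^ l"
    by (auto simp: m_def divide_strict_right_mono)
  have "real j / 2 ^ l \<in> b" "(real j + 1) / 2 ^ l \<in> b"
    by (auto simp: l dyadic_interval_def divide_right_mono)
  then have "real i / 2 ^ k < m" "m < (real i + 1) / 2 ^ k" "real i' / 2 ^ k' < m" "m < (real i' + 1) / 2 ^ k'"
    using sub m unfolding k k' dyadic_interval_def by fastforce+
  then show ?thesis
    unfolding k k' using dyadic_interval_nested nat_le_linear by metis
qed

interpretation dyadic: finite_forest "tree N" "tree_boundary N" for N
proof
  fix b x y
  assume "b \<in> tree_boundary N" "x \<in> tree N" "y \<in> tree N" "b \<le> x" "b \<le> y"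
  then show "x \<le> y \<or> y \<le> x" using tree_chain tree_boundary_subset by blast
qed (auto simp: finite_tree tree_boundary_subset)

lemma node_le_iff: "\<alpha> \<in> bitree N \<Longrightarrow> \<alpha> \<preceq> \<beta> \<longleftrightarrow> \<alpha> \<le> \<beta>"
  by (auto simp: node_le_def rect_def bitree_def tree_def dyadic_interval_def less_eq_prod_def
      times_subset_iff divide_right_mono)

lemma dyadic_interval_bisect:
  "dyadic_interval k j = dyadic_interval (Suc k) (2 * j) \<union> dyadic_interval (Suc k) (2 * j + 1)"
  by (auto simp: dyadic_interval_def field_simps)

lemma covered_by_boundary:
  assumes "k \<le> N" "j < 2 ^ k" "p \<in> dyadic_interval k j"
  shows "\<exists>a\<in>tree_boundary N. p \<in> a \<and> a \<subseteq> dyadic_interval k j"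
  using assms
proof (induction k arbitrary: j rule: inc_induct)
  case base
  then show ?case by (auto simp: tree_boundary_def)
next
  case (step k)
  from step.prems(2) consider "p \<in> dyadic_interval (Suc k) (2 * j)" | "p \<in> dyadic_interval (Suc k) (2 * j + 1)"
    unfolding dyadic_interval_bisect[of k j] by blast
  then show ?case
  proof cases
    case 1
    show ?thesis using step.IH[OF _ 1] step.prems(1) unfolding dyadic_interval_bisect[of k j] by auto
  next
    case 2
    show ?thesis using step.IH[OF _ 2] step.prems(1) unfolding dyadic_interval_bisect[of k j] by auto
  qed
qed

lemma tree_covered_by_boundary:
  "x \<in> tree N \<Longrightarrow> p \<in> x \<Longrightarrow> \<exists>a\<in>tree_boundary N. p \<in> a \<and> a \<subseteq> x"
  using covered_by_boundary by (auto simp: tree_def)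

text \<open>
  The centre of a boundary interval lies in no other one. It is the witness that turns an inclusion between
  unions of closed squares into an inclusion between sets of boundary nodes.
\<close>
lemma boundary_center:
  assumes "a \<in> tree_boundary N"
  obtains m where "m \<in> a" "\<And>a'. a' \<in> tree_boundary N \<Longrightarrow> m \<in> a' \<Longrightarrow> a' = a"
proof -
  obtain j where j: "a = dyadic_interval N j" using assms by (auto simp: tree_boundary_def)
  let ?m = "(real j + 1 / 2) / 2 ^ N"
  show ?thesis
  proof (rule that[of ?m])
    show "?m \<in> a" by (auto simp: j dyadic_interval_def divide_right_mono)
    fix a' assume "a' \<in> tree_boundary N" and m: "?m \<in> a'"
    then obtain i where i: "a' = dyadic_interval N i" by (auto simp: tree_boundary_def)
    have "real i \<le> real j + 1 / 2" "real j + 1 / 2 \<le> real i + 1"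
      using m by (auto simp: i dyadic_interval_def divide_le_cancel)
    then have "i = j" by linarith
    then show "a' = a" by (simp add: i j)
  qed
qed

text \<open>
  The geometric and the order-theoretic notion of a rectangle inside \<open>E\<close> agree: centres of boundary squares
  detect membership in \<open>E\<close>, and conversely each rectangle is covered by the boundary squares below it.
\<close>
lemma rects_inside_eq:
  assumes E: "E \<subseteq> bitree_boundary N"
  shows "rects_inside N E = {\<alpha> \<in> bitree N. \<forall>\<omega>\<in>bitree_boundary N. \<omega> \<le> \<alpha> \<longrightarrow> \<omega> \<in> E}"
proof (intro equalityI subsetI)
  fix \<alpha> assume "\<alpha> \<in> rects_inside N E"
  then have \<alpha>: "\<alpha> \<in> bitree N" "rect \<alpha> \<subseteq> (\<Union>\<omega>\<in>E. rect \<omega>)" by (auto simp: rects_inside_def)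
  have "\<omega> \<in> E" if \<omega>: "\<omega> \<in> bitree_boundary N" "\<omega> \<le> \<alpha>" for \<omega>
  proof -
    obtain a b where ab: "\<omega> = (a, b)" "a \<in> tree_boundary N" "b \<in> tree_boundary N"
      using \<omega> by (auto simp: bitree_boundary_def)
    obtain p where p: "p \<in> a" "\<And>a'. a' \<in> tree_boundary N \<Longrightarrow> p \<in> a' \<Longrightarrow> a' = a"
      using boundary_center[OF ab(2)] by blast
    obtain q where q: "q \<in> b" "\<And>b'. b' \<in> tree_boundary N \<Longrightarrow> q \<in> b' \<Longrightarrow> b' = b"
      using boundary_center[OF ab(3)] by blast
    have "(p, q) \<in> rect \<alpha>" using \<omega>(2) p q by (auto simp: ab rect_def less_eq_prod_def)
    then obtain \<omega>' where \<omega>': "\<omega>' \<in> E" "(p, q) \<in> rect \<omega>'" using \<alpha>(2) by blast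
    then have "fst \<omega>' = a" "snd \<omega>' = b"
      using E p(2) q(2) by (auto simp: rect_def bitree_boundary_def)
    then have "\<omega>' = \<omega>" by (simp add: ab prod_eq_iff)
    then show ?thesis using \<omega>' by simp
  qed
  then show "\<alpha> \<in> {\<alpha> \<in> bitree N. \<forall>\<omega>\<in>bitree_boundary N. \<omega> \<le> \<alpha> \<longrightarrow> \<omega> \<in> E}" using \<alpha>(1) by blast
next
  fix \<alpha> assume "\<alpha> \<in> {\<alpha> \<in> bitree N. \<forall>\<omega>\<in>bitree_boundary N. \<omega> \<le> \<alpha> \<longrightarrow> \<omega> \<in> E}"
  then have \<alpha>: "\<alpha> \<in> bitree N" and sub: "\<And>\<omega>. \<omega> \<in> bitree_boundary N \<Longrightarrow> \<omega> \<le> \<alpha> \<Longrightarrow> \<omega> \<in> E" by auto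
  have "z \<in> (\<Union>\<omega>\<in>E. rect \<omega>)" if z: "z \<in> rect \<alpha>" for z
  proof -
    have xy: "fst \<alpha> \<in> tree N" "snd \<alpha> \<in> tree N" "fst z \<in> fst \<alpha>" "snd z \<in> snd \<alpha>"
      using \<alpha> z by (auto simp: bitree_def rect_def)
    obtain a where a: "a \<in> tree_boundary N" "fst z \<in> a" "a \<subseteq> fst \<alpha>"
      using tree_covered_by_boundary xy by blast
    obtain b where b: "b \<in> tree_boundary N" "snd z \<in> b" "b \<subseteq> snd \<alpha>"
      using tree_covered_by_boundary xy by blast
    have "(a, b) \<in> E" using a b by (intro sub) (auto simp: bitree_boundary_def less_eq_prod_def)
    moreover have "z \<in> rect (a, b)" using a b by (simp add: rect_def mem_Times_iff)
    ultimately show ?thesis by blast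
  qed
  then show "\<alpha> \<in> rects_inside N E" using \<alpha> by (auto simp: rects_inside_def)
qed

lemma hardy_eq_potential: "\<alpha> \<in> bitree N \<Longrightarrow> hardy N \<phi> \<alpha> = dyadic.potential N \<phi> \<alpha>"
  unfolding hardy_def dyadic.potential_def
  by (intro sum.cong) (auto simp: node_le_iff bitree_def)

lemma rect_mass_eq_mass: "rect_mass N \<mu> \<alpha> = dyadic.mass N \<mu> \<alpha>"
proof -
  have "{\<omega> \<in> bitree_boundary N. \<omega> \<preceq> \<alpha>} = {\<omega> \<in> tree_boundary N \<times> tree_boundary N. \<omega> \<le> \<alpha>}"
    using node_le_iff bitree_boundary_subset unfolding bitree_boundary_def by blast
  then show ?thesis by (simp add: rect_mass_def dyadic.mass_def)
qed

lemma hardy_adjoint_eq_mass: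
  assumes "boundary_measure N \<mu>"
  shows "hardy_adjoint N (\<lambda>\<omega>. \<psi> \<omega> * \<mu> \<omega>) \<alpha> = dyadic.mass N (\<lambda>\<omega>. \<psi> \<omega> * \<mu> \<omega>) \<alpha>"
proof -
  have "hardy_adjoint N (\<lambda>\<omega>. \<psi> \<omega> * \<mu> \<omega>) \<alpha> = rect_mass N (\<lambda>\<omega>. \<psi> \<omega> * \<mu> \<omega>) \<alpha>"
    unfolding hardy_adjoint_def rect_mass_def
    using assms bitree_boundary_subset finite_bitree[of N]
    by (intro sum.mono_neutral_right) (auto simp: boundary_measure_def)
  then show ?thesis by (simp add: rect_mass_eq_mass)
qed

lemma carleson_iff_box: "carleson N \<mu> C \<longleftrightarrow> dyadic.carleson_box N \<mu> C"
  unfolding carleson_def dyadic.carleson_box_def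
  by (auto simp: rects_inside_eq rect_mass_eq_mass bitree_def bitree_boundary_def)

lemma second_embedding_iff_mass:
  assumes "boundary_measure N \<mu>"
  shows "second_embedding N \<mu> C \<longleftrightarrow> (\<forall>\<psi>. (\<Sum>\<alpha>\<in>bitree N. (dyadic.mass N (\<lambda>\<omega>. \<psi> \<omega> * \<mu> \<omega>) \<alpha>)\<^sup>2)
           \<le> C * (\<Sum>\<omega>\<in>bitree_boundary N. (\<psi> \<omega>)\<^sup>2 * \<mu> \<omega>))"
  by (simp add: second_embedding_def hardy_adjoint_eq_mass[OF assms])

lemma hardy_embedding_iff_potential:
  "hardy_embedding N \<mu> C \<longleftrightarrow> (\<forall>\<phi>. (\<Sum>\<omega>\<in>bitree_boundary N. (dyadic.potential N \<phi> \<omega>)\<^sup>2 * \<mu> \<omega>)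
           \<le> C * (\<Sum>\<alpha>\<in>bitree N. (\<phi> \<alpha>)\<^sup>2))"
proof -
  have "(\<Sum>\<omega>\<in>bitree_boundary N. \<bar>hardy N \<phi> \<omega>\<bar>\<^sup>2 * \<mu> \<omega>)
      = (\<Sum>\<omega>\<in>bitree_boundary N. (dyadic.potential N \<phi> \<omega>)\<^sup>2 * \<mu> \<omega>)" for \<phi>
    by (intro sum.cong refl) (simp add: hardy_eq_potential[OF subsetD[OF bitree_boundary_subset]])
  then show ?thesis by (simp add: hardy_embedding_def)
qed

lemma boundary_measure_nonneg:
  "boundary_measure N \<mu> \<Longrightarrow> \<omega> \<in> tree_boundary N \<times> tree_boundary N \<Longrightarrow> 0 \<le> \<mu> \<omega>"
  by (auto simp: boundary_measure_def bitree_boundary_def)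

section \<open>The implications between the four conditions\<close>

lemma mass_embedding_imp_second_embedding:
  assumes \<mu>: "boundary_measure N \<mu>" and emb: "dyadic.mass_embedding N \<mu> C"
  shows "second_embedding N \<mu> C"
  unfolding second_embedding_iff_mass[OF \<mu>]
proof
  fix \<psi> :: "node \<Rightarrow> real"
  have "\<bar>dyadic.mass N (\<lambda>\<omega>. \<psi> \<omega> * \<mu> \<omega>) \<alpha>\<bar> \<le> dyadic.mass N (\<lambda>\<omega>. \<bar>\<psi> \<omega>\<bar> * \<mu> \<omega>) \<alpha>" for \<alpha>
    unfolding dyadic.mass_def using boundary_measure_nonneg[OF \<mu>]
    by (intro order_trans[OF sum_abs] sum_mono) (auto simp: abs_mult)
  then have "(\<Sum>\<alpha>\<in>bitree N. (dyadic.mass N (\<lambda>\<omega>. \<psi> \<omega> * \<mu> \<omega>) \<alpha>)\<^sup>2)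
      \<le> (\<Sum>\<alpha>\<in>bitree N. (dyadic.mass N (\<lambda>\<omega>. \<bar>\<psi> \<omega>\<bar> * \<mu> \<omega>) \<alpha>)\<^sup>2)"
    by (intro sum_mono) (metis abs_ge_zero power2_abs power_mono)
  also have "\<dots> \<le> C * (\<Sum>\<omega>\<in>bitree_boundary N. \<bar>\<psi> \<omega>\<bar>\<^sup>2 * \<mu> \<omega>)"
    using emb[unfolded dyadic.mass_embedding_def, rule_format, of "\<lambda>\<omega>. \<bar>\<psi> \<omega>\<bar>"]
    by (simp add: bitree_def bitree_boundary_def)
  finally show "(\<Sum>\<alpha>\<in>bitree N. (dyadic.mass N (\<lambda>\<omega>. \<psi> \<omega> * \<mu> \<omega>) \<alpha>)\<^sup>2)
           \<le> C * (\<Sum>\<omega>\<in>bitree_boundary N. (\<psi> \<omega>)\<^sup>2 * \<mu> \<omega>)" by simp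
qed

lemma second_embedding_imp_hardy_embedding:
  assumes \<mu>: "boundary_measure N \<mu>" and C: "0 \<le> C" and emb: "second_embedding N \<mu> C"
  shows "hardy_embedding N \<mu> C"
  unfolding hardy_embedding_iff_potential
proof
  fix \<phi> :: "node \<Rightarrow> real"
  have emb': "dyadic.mass_embedding N \<mu> C"
    using emb unfolding second_embedding_iff_mass[OF \<mu>] dyadic.mass_embedding_def
    by (simp add: bitree_def bitree_boundary_def)
  have "\<bar>dyadic.potential N \<phi> \<omega>\<bar> \<le> dyadic.potential N (\<lambda>\<alpha>. \<bar>\<phi> \<alpha>\<bar>) \<omega>" for \<omega>
    unfolding dyadic.potential_def by (rule sum_abs)
  then have "(\<Sum>\<omega>\<in>bitree_boundary N. (dyadic.potential N \<phi> \<omega>)\<^sup>2 * \<mu> \<omega>)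
      \<le> (\<Sum>\<omega>\<in>bitree_boundary N. (dyadic.potential N (\<lambda>\<alpha>. \<bar>\<phi> \<alpha>\<bar>) \<omega>)\<^sup>2 * \<mu> \<omega>)"
    using \<mu> by (intro sum_mono mult_right_mono abs_le_square_iff[THEN iffD1])
      (auto simp: boundary_measure_def intro: order_trans[OF _ abs_ge_self])
  also have "\<dots> \<le> C * (\<Sum>\<alpha>\<in>bitree N. \<bar>\<phi> \<alpha>\<bar>\<^sup>2)"
    unfolding bitree_def bitree_boundary_def
    by (rule dyadic.potential_embedding[OF emb' C]) (auto intro: boundary_measure_nonneg[OF \<mu>])
  finally show "(\<Sum>\<omega>\<in>bitree_boundary N. (dyadic.potential N \<phi> \<omega>)\<^sup>2 * \<mu> \<omega>) \<le> C * (\<Sum>\<alpha>\<in>bitree N. (\<phi> \<alpha>)\<^sup>2)"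
    by simp
qed

text \<open>
  The same duality as in \<open>potential_embedding\<close> with the roles exchanged: the left side is the pairing of
  \<open>\<psi>\<mu>\<close> with the potential of its own mass function.
\<close>
lemma hardy_embedding_imp_second_embedding:
  assumes \<mu>: "boundary_measure N \<mu>" and C: "0 \<le> C" and emb: "hardy_embedding N \<mu> C"
  shows "second_embedding N \<mu> C"
  unfolding second_embedding_iff_mass[OF \<mu>]
proof
  fix \<psi> :: "node \<Rightarrow> real"
  let ?m = "dyadic.mass N (\<lambda>\<omega>. \<psi> \<omega> * \<mu> \<omega>)"
  let ?S = "\<Sum>\<alpha>\<in>bitree N. (?m \<alpha>)\<^sup>2" and ?\<Psi> = "\<Sum>\<omega>\<in>bitree_boundary N. (\<psi> \<omega>)\<^sup>2 * \<mu> \<omega>"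
  have \<mu>0: "0 \<le> \<mu> \<omega>" if "\<omega> \<in> bitree_boundary N" for \<omega> using \<mu> that by (simp add: boundary_measure_def)
  have S0: "0 \<le> ?S" by (intro sum_nonneg) auto
  have \<Psi>0: "0 \<le> ?\<Psi>" using \<mu>0 by (intro sum_nonneg) auto
  have "?S = (\<Sum>\<alpha>\<in>bitree N. ?m \<alpha> * ?m \<alpha>)" by (simp add: power2_eq_square)
  also have "\<dots> = (\<Sum>\<omega>\<in>bitree_boundary N. (\<psi> \<omega> * \<mu> \<omega>) * dyadic.potential N ?m \<omega>)"
    unfolding bitree_def bitree_boundary_def by (rule dyadic.duality)
  finally have "?S\<^sup>2 = (\<Sum>\<omega>\<in>bitree_boundary N. (\<psi> \<omega> * \<mu> \<omega>) * dyadic.potential N ?m \<omega>)\<^sup>2" by (rule arg_cong)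
  also have "\<dots> \<le> ?\<Psi> * (\<Sum>\<omega>\<in>bitree_boundary N. (dyadic.potential N ?m \<omega>)\<^sup>2 * \<mu> \<omega>)"
    using \<mu>0 by (intro square_sum_le_product) (auto simp: power2_eq_square)
  also have "\<dots> \<le> ?\<Psi> * (C * ?S)"
    using emb \<Psi>0 unfolding hardy_embedding_iff_potential by (intro mult_left_mono) blast+
  finally have *: "?S * ?S \<le> ?S * (C * ?\<Psi>)" by (simp add: power2_eq_square ac_simps)
  show "?S \<le> C * ?\<Psi>"
  proof (cases "?S = 0")
    case True
    show ?thesis unfolding True using C \<Psi>0 by simp
  next
    case False
    then have "0 < ?S" using S0 by linarith
    then show ?thesis by (rule mult_left_le_imp_le[OF *])
  qed
qed

text \<open>
  Test the embedding on the indicator function of \<open>E \<inter> F\<close>. For a rectangle inside \<open>F\<close> the boundary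
  nodes below it lie in \<open>F\<close>, so restricting the measure to \<open>E\<close> or to \<open>E \<inter> F\<close> gives it the same mass.
\<close>
lemma second_embedding_imp_hereditary_carleson:
  assumes \<mu>: "boundary_measure N \<mu>" and emb: "second_embedding N \<mu> C"
  shows "hereditary_carleson N \<mu> C"
  unfolding hereditary_carleson_def carleson_def
proof (intro allI impI)
  fix E F assume E: "E \<subseteq> bitree_boundary N" and F: "F \<subseteq> bitree_boundary N"
  define \<psi> :: "node \<Rightarrow> real" where "\<psi> \<omega> = (if \<omega> \<in> E \<inter> F then 1 else 0)" for \<omega>
  have "(\<Sum>\<alpha>\<in>rects_inside N F. (rect_mass N (restrict_measure \<mu> E) \<alpha>)\<^sup>2)
      = (\<Sum>\<alpha>\<in>rects_inside N F. (dyadic.mass N (\<lambda>\<omega>. \<psi> \<omega> * \<mu> \<omega>) \<alpha>)\<^sup>2)"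
  proof (intro sum.cong refl arg_cong[where f = "\<lambda>z. z\<^sup>2"])
    fix \<alpha> assume "\<alpha> \<in> rects_inside N F"
    then have "\<omega> \<in> F" if "\<omega> \<in> bitree_boundary N" "\<omega> \<le> \<alpha>" for \<omega>
      using that unfolding rects_inside_eq[OF F] by blast
    then show "rect_mass N (restrict_measure \<mu> E) \<alpha> = dyadic.mass N (\<lambda>\<omega>. \<psi> \<omega> * \<mu> \<omega>) \<alpha>"
      unfolding rect_mass_eq_mass dyadic.mass_def
      by (intro sum.cong) (auto simp: \<psi>_def restrict_measure_def bitree_boundary_def)
  qed
  also have "\<dots> \<le> (\<Sum>\<alpha>\<in>bitree N. (dyadic.mass N (\<lambda>\<omega>. \<psi> \<omega> * \<mu> \<omega>) \<alpha>)\<^sup>2)"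
    by (intro sum_mono2 finite_bitree) (auto simp: rects_inside_def)
  also have "\<dots> \<le> C * (\<Sum>\<omega>\<in>bitree_boundary N. (\<psi> \<omega>)\<^sup>2 * \<mu> \<omega>)"
    using emb unfolding second_embedding_iff_mass[OF \<mu>] by blast
  also have "(\<Sum>\<omega>\<in>bitree_boundary N. (\<psi> \<omega>)\<^sup>2 * \<mu> \<omega>) = (\<Sum>\<omega>\<in>F. restrict_measure \<mu> E \<omega>)"
    using F finite_subset[OF bitree_boundary_subset finite_bitree]
    by (intro sum.mono_neutral_cong_right) (auto simp: \<psi>_def restrict_measure_def)
  finally show "(\<Sum>\<alpha>\<in>rects_inside N F. (rect_mass N (restrict_measure \<mu> E) \<alpha>)\<^sup>2)
      \<le> C * (\<Sum>\<omega>\<in>F. restrict_measure \<mu> E \<omega>)" .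
qed

lemma hereditary_carleson_imp_carleson:
  assumes "hereditary_carleson N \<mu> C"
  shows "carleson N \<mu> C"
proof -
  let ?\<nu> = "restrict_measure \<mu> (bitree_boundary N)"
  have "rect_mass N ?\<nu> = rect_mass N \<mu>"
    by (intro ext) (auto simp: rect_mass_def restrict_measure_def intro!: sum.cong)
  moreover have "(\<Sum>\<omega>\<in>E. ?\<nu> \<omega>) = (\<Sum>\<omega>\<in>E. \<mu> \<omega>)" if "E \<subseteq> bitree_boundary N" for E
    using that by (intro sum.cong) (auto simp: restrict_measure_def)
  ultimately show ?thesis
    using assms unfolding hereditary_carleson_def by (auto simp: carleson_def)
qed

lemma carleson_imp_second_embedding:
  assumes \<mu>: "boundary_measure N \<mu>" and C: "0 \<le> C" and carl: "carleson N \<mu> C"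
  shows "second_embedding N \<mu> (256 * 600 ^ 6 * C)"
  using dyadic.carleson_imp_mass_embedding[OF carl[unfolded carleson_iff_box] C boundary_measure_nonneg[OF \<mu>]]
  by (rule mass_embedding_imp_second_embedding[OF \<mu>])

text \<open>This allows the given constant \<open>C\<close>, which may be negative, to be replaced by its absolute value.\<close>
lemma constants_enlarge:
  assumes \<mu>: "boundary_measure N \<mu>"
    and P: "P \<in> {carleson, hereditary_carleson, hardy_embedding, second_embedding}"
    and le: "C \<le> C'" and "P N \<mu> C"
  shows "P N \<mu> C'"
proof -
  have \<mu>0: "0 \<le> \<mu> \<omega>" if "\<omega> \<in> bitree_boundary N" for \<omega> using \<mu> that by (simp add: boundary_measure_def)
  have enlarge: "x \<le> C * y \<Longrightarrow> 0 \<le> y \<Longrightarrow> x \<le> C' * y" for x y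
    using mult_right_mono[OF le, of y] by linarith
  have car: "carleson N \<nu> C'" if "carleson N \<nu> C" "\<And>\<omega>. \<omega> \<in> bitree_boundary N \<Longrightarrow> 0 \<le> \<nu> \<omega>" for \<nu>
    using that unfolding carleson_def by (auto intro!: enlarge sum_nonneg)
  consider "P = carleson" | "P = hereditary_carleson" | "P = hardy_embedding" | "P = second_embedding"
    using P by blast
  then show ?thesis
  proof cases
    case 1
    then show ?thesis using car \<open>P N \<mu> C\<close> \<mu>0 by blast
  next
    case 2
    have "0 \<le> restrict_measure \<mu> E \<omega>" if "\<omega> \<in> bitree_boundary N" for E \<omega>
      using \<mu>0[OF that] by (simp add: restrict_measure_def)
    then show ?thesis using car \<open>P N \<mu> C\<close> unfolding 2 hereditary_carleson_def by blast
  next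
    case 3
    then show ?thesis using \<open>P N \<mu> C\<close> unfolding 3 hardy_embedding_def by (auto intro!: enlarge sum_nonneg)
  next
    case 4
    then show ?thesis using \<open>P N \<mu> C\<close> \<mu>0 unfolding 4 second_embedding_def by (auto intro!: enlarge sum_nonneg)
  qed
qed

theorem theorem1p5:
  "\<forall>P \<in> {carleson, hereditary_carleson, hardy_embedding, second_embedding}.
   \<forall>Q \<in> {carleson, hereditary_carleson, hardy_embedding, second_embedding}.
   \<forall>C :: real. \<exists>C' :: real. \<forall>N :: nat. \<forall>\<mu> :: node \<Rightarrow> real.
     N \<ge> 1 \<and> boundary_measure N \<mu> \<and> P N \<mu> C \<longrightarrow> Q N \<mu> C'"
proof (intro ballI allI)
  fix P Q :: "nat \<Rightarrow> (node \<Rightarrow> real) \<Rightarrow> real \<Rightarrow> bool" and C :: real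
  assume P: "P \<in> {carleson, hereditary_carleson, hardy_embedding, second_embedding}"
    and Q: "Q \<in> {carleson, hereditary_carleson, hardy_embedding, second_embedding}"
  let ?K = "256 * 600 ^ 6 * \<bar>C\<bar>"
  have "Q N \<mu> ?K" if \<mu>: "boundary_measure N \<mu>" and PC: "P N \<mu> C" for N \<mu>
  proof -
    have "P N \<mu> \<bar>C\<bar>" by (rule constants_enlarge[OF \<mu> P _ PC]) simp
    then have "carleson N \<mu> \<bar>C\<bar>"
      using P hereditary_carleson_imp_carleson second_embedding_imp_hereditary_carleson[OF \<mu>]
        hardy_embedding_imp_second_embedding[OF \<mu>, of "\<bar>C\<bar>"] by auto
    then have "second_embedding N \<mu> ?K" by (intro carleson_imp_second_embedding \<mu>) auto
    then show ?thesis
      using Q hereditary_carleson_imp_carleson second_embedding_imp_hereditary_carleson[OF \<mu>]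
        second_embedding_imp_hardy_embedding[OF \<mu>, of ?K] by auto
  qed
  then show "\<exists>C'. \<forall>N \<mu>. N \<ge> 1 \<and> boundary_measure N \<mu> \<and> P N \<mu> C \<longrightarrow> Q N \<mu> C'" by blast
qed

end
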